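(* Let $A$ be a metric algebraic structure (with function symbols $\mathbf F$, terms $\mathbf T$, state symbols $\mathbf G$, metric $d$, domains $\mathbf D$, and set $\mathbf U$ of continuity symbols), let $(A_r)_{r\ge1}$ be a sequence of structures of the same type as $A$, let $N(r)>0$ and $L(\varepsilon)>0$ be normalization functions, and let $G\subset A$ be a subset. (1) (Algebraic invariance of the entropy dimension.) Let $\dim$ be defined using the microstate spaces $\mathrm{MS}$, and assume that for every $\eta\in\mathbf U$ and every $c\in(0,1)$ $$\lim_{\varepsilon\to0}\frac{L(\eta(c\varepsilon)/2)}{L(\varepsilon)}=1$$ (existence of the limit being part of the assumption). If $A$ is algebraically generated by $G$, i.e. $G^{\mathbf T}=A$, then $\dim(A)=\dim(G)$. (2) (Topological invariance of the entropy.) Let $h$ be defined using the contractive microstate spaces $\mathrm{CMS}$ in place of $\mathrm{MS}$, or else suppose that $d\in\mathbf G$ and let $h$ be defined using $\mathrm{MS}$. If $G$ is a topological generating set of $A$, then $h(A)=h(G)$.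
   Context: Structures. $A$ is a set with a set $\mathbf F$ of function symbols $f:A^n\to A$ ($n\ge 0$ the arity; constants are allowed). $\mathbf T$ is the set of terms: functions obtained by finite iterated composition of elements of $\mathbf F$ (variables, i.e. coordinate projections, count as terms). For $F\subset A$ and $T\subset\mathbf T$, $F^T\subset A$ is the set of all values obtained by applying elements of $T$ to elements of $F$; thus $F^{\mathbf T}$ is the substructure generated by $F$. $\mathbf G$ is a set of state symbols $g:A^n\to\mathbb R$, $n\ge1$. $A$ carries a metric $d$ and a family $\mathbf D$ of subsets (domains) exhausting $A$, each complete and bounded for $d$. Uniform continuity: for every $t\in\mathbf T\cup\mathbf G$ of arity $n>0$ and all $D_1,\dots,D_n\in\mathbf D$ there is a given modulus $\eta=\eta_t^{D_1,\dots,D_n}:(0,1]\to(0,1]$ such that for each $1\le j\le n$, all $a_i\in D_i$ ($i\ne j$), all $a,b\in D_j$ and all $\varepsilon$: $d(a,b)<\eta(\varepsilon)$ implies $d\big(t(a_1,\dots,a_{j-1},a,a_{j+1},\dots,a_n),t(a_1,\dots,a_{j-1},b,a_{j+1},\dots,a_n)\big)<\varepsilon$ (in $\mathbb R$, $d$ is the usual distance). All of this data is a language (in the sense of continuous logic), of which $A$ is an interpretation; a structure $B$ of the same type as $A$ is another interpretation of the same function symbols, state symbols, metric, domains, with the same moduli of continuity. $\mathbf U$ is the set of all functions $\min_{t\in T}\eta_t^{D_1,\dots,D_n}:(0,1]\to(0,1]$ with $T\subset\mathbf T\cup\mathbf G$ finite consisting of $n$-ary elements ($n\geq 1$) and $D_1,\dots,D_n\in\mathbf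 D$. Microstates. Write $X\ll Y$ for "$X$ is a finite subset of $Y$". Let $B$ be a structure of the same type as $A$, $F\ll A$, $R\subset\mathbf T\cup\mathbf G$, $\delta\ge0$. A map $\sigma:F\to B$ is an $(R,\delta)$-microstate if (i) $d(\sigma(a_{n+1}),t(\sigma(a_1),\dots,\sigma(a_n)))\le\delta$ whenever $t\in R\cap\mathbf T$ and $a_1,\dots,a_{n+1}\in F$ satisfy $a_{n+1}=t(a_1,\dots,a_n)$; and (ii) $|g(a_1,\dots,a_n)-g(\sigma(a_1),\dots,\sigma(a_n))|\le\delta$ for all $g\in R\cap\mathbf G$, $a_1,\dots,a_n\in F$. It is domain preserving if, for every $a\in F$, $\sigma(a)$ lies in every domain that $a$ lies in; it is $\delta$-contractive if $d(\sigma(a),\sigma(b))\le d(a,b)+\delta$ for all $a,b\in F$. $\mathrm{MS}(F,R,\delta,B)$ is the set of domain preserving $(R,\delta)$-microstates $F\to B$, and $\mathrm{CMS}(F,R,\delta,B)$ the set of those that are also $\delta$-contractive. For $E\subset F$ put $d_E(\sigma,\tau)=\sup_{s\in E}d(\sigma(s),\tau(s))$, and let $N_{E,\varepsilon}(\cdot)$ be the maximal cardinality of an $\varepsilon$-separated subset with respect to $d_E$. Entropy and dimension. For finite $E\subset F\subset A$, $R\ll\mathbf T\cup\mathbf G$, $\delta,\varepsilon>0$: $$h(E,F,R,\delta,\varepsilon)=\limsup_{r\to\infty}\frac{\log N_{E,\varepsilon}(\mathrm{MS}(F,R,\delta,A_r))}{N(r)}\quad(\log 0=-\infty).$$ For $B\subset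 A$ arbitrary and $E\ll B$: $h(E,B,\varepsilon)=\inf_{\delta>0}\inf_{R\ll\mathbf T\cup\mathbf G}\inf_{E\subset F\ll B}h(E,F,R,\delta,\varepsilon)$. For $G\subset A$: $$h(G)=\sup_{E\ll G}\sup_{\varepsilon>0}h(E,G^{\mathbf T},\varepsilon),\qquad \dim(G)=\sup_{E\ll G}\limsup_{\varepsilon\to0}\frac{h(E,G^{\mathbf T},\varepsilon)}{L(\varepsilon)}.$$ "Defined using $\mathrm{CMS}$" means $\mathrm{MS}$ is replaced by $\mathrm{CMS}$ in the first formula. Topological generation. $G\subset A$ is a topological generating set if for every $\varepsilon>0$ and $x\in A$ there is $y\in G^{\mathbf T}$ with $d(x,y)<\varepsilon$ and $y$ in every domain that $x$ is in. *)

theory Defs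
  imports "HOL-Analysis.Analysis"
begin

datatype 'f trm = Var nat | Fun 'f "'f trm list"

text \<open>
  A term is used as a function of a specified number of variables, so that an n-ary term is a
  pair of a number n and a syntactic term whose variables are among the first n ones.
  Terms are syntactic because the same term is to be evaluated in different structures.
\<close>

datatype ('f, 'g) symb = TermSym nat "'f trm" | StateSym 'g

record ('f, 'g, 'i) lang =
  fsyms :: "'f set"
  farity :: "'f \<Rightarrow> nat"
  gsyms :: "'g set"
  garity :: "'g \<Rightarrow> nat"
  dsyms :: "'i set"
  modulus :: "('f, 'g) symb \<Rightarrow> 'i list \<Rightarrow> real \<Rightarrow> real"

inductive_set terms :: "('f, 'g, 'i) lang \<Rightarrow> nat \<Rightarrow> 'f trm set"
  for \<L> :: "('f, 'g, 'i) lang" and n :: nat where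
  Var: "i < n \<Longrightarrow> Var i \<in> terms \<L> n"
| Fun: "f \<in> fsyms \<L> \<Longrightarrow> length ts = farity \<L> f \<Longrightarrow> (\<And>t. t \<in> set ts \<Longrightarrow> t \<in> terms \<L> n)
        \<Longrightarrow> Fun f ts \<in> terms \<L> n"

definition symbols :: "('f, 'g, 'i) lang \<Rightarrow> ('f, 'g) symb set" where
  "symbols \<L> = {TermSym n t | n t. t \<in> terms \<L> n} \<union> StateSym ` gsyms \<L>"

fun arity :: "('f, 'g, 'i) lang \<Rightarrow> ('f, 'g) symb \<Rightarrow> nat" where
  "arity \<L> (TermSym n t) = n"
| "arity \<L> (StateSym g) = garity \<L> g"

definition dom_tuples :: "('f, 'g, 'i) lang \<Rightarrow> nat \<Rightarrow> 'i list set" where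
  "dom_tuples \<L> n = {Ds. length Ds = n \<and> set Ds \<subseteq> dsyms \<L>}"

text \<open>Moduli of continuity are only meaningful on the interval (0,1].\<close>

definition language :: "('f, 'g, 'i) lang \<Rightarrow> bool" where
  "language \<L> \<longleftrightarrow>
     (\<forall>g\<in>gsyms \<L>. garity \<L> g \<ge> 1) \<and>
     (\<forall>s\<in>symbols \<L>. arity \<L> s > 0 \<longrightarrow>
        (\<forall>Ds\<in>dom_tuples \<L> (arity \<L> s). modulus \<L> s Ds ` {0<..1} \<subseteq> {0<..1}))"

definition continuity_symbols :: "('f, 'g, 'i) lang \<Rightarrow> (real \<Rightarrow> real) set" where
  "continuity_symbols \<L> =
     {\<lambda>\<epsilon>. Min ((\<lambda>s. modulus \<L> s Ds \<epsilon>) ` T) | T Ds n.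
        n \<ge> 1 \<and> finite T \<and> T \<noteq> {} \<and> T \<subseteq> symbols \<L> \<and> (\<forall>s\<in>T. arity \<L> s = n) \<and>
        Ds \<in> dom_tuples \<L> n}"

record ('a, 'f, 'g, 'i) struct =
  carr :: "'a set"
  metr :: "'a \<Rightarrow> 'a \<Rightarrow> real"
  fint :: "'f \<Rightarrow> 'a list \<Rightarrow> 'a"
  gint :: "'g \<Rightarrow> 'a list \<Rightarrow> real"
  dint :: "'i \<Rightarrow> 'a set"

primrec eval :: "('a, 'f, 'g, 'i) struct \<Rightarrow> 'a list \<Rightarrow> 'f trm \<Rightarrow> 'a" where
  "eval S xs (Var i) = xs ! i"
| "eval S xs (Fun f ts) = fint S f (map (eval S xs) ts)"

fun value_dist ::
  "('a, 'f, 'g, 'i) struct \<Rightarrow> ('f, 'g) symb \<Rightarrow> 'a list \<Rightarrow> 'a list \<Rightarrow> real" where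
  "value_dist S (TermSym n t) xs ys = metr S (eval S xs t) (eval S ys t)"
| "value_dist S (StateSym g) xs ys = \<bar>gint S g xs - gint S g ys\<bar>"

definition uniformly_cont :: "('f, 'g, 'i) lang \<Rightarrow> ('a, 'f, 'g, 'i) struct \<Rightarrow> bool" where
  "uniformly_cont \<L> S \<longleftrightarrow>
     (\<forall>s\<in>symbols \<L>. \<forall>Ds\<in>dom_tuples \<L> (arity \<L> s). \<forall>j<arity \<L> s. \<forall>xs a b \<epsilon>.
        length xs = arity \<L> s \<longrightarrow>
        (\<forall>i<arity \<L> s. i \<noteq> j \<longrightarrow> xs ! i \<in> dint S (Ds ! i)) \<longrightarrow>
        a \<in> dint S (Ds ! j) \<longrightarrow> b \<in> dint S (Ds ! j) \<longrightarrow> 0 < \<epsilon> \<longrightarrow> \<epsilon> \<le> 1 \<longrightarrow>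
        metr S a b < modulus \<L> s Ds \<epsilon> \<longrightarrow>
        value_dist S s (xs[j := a]) (xs[j := b]) < \<epsilon>)"

definition struct_of :: "('f, 'g, 'i) lang \<Rightarrow> ('a, 'f, 'g, 'i) struct \<Rightarrow> bool" where
  "struct_of \<L> S \<longleftrightarrow>
     Metric_space (carr S) (metr S) \<and>
     (\<forall>f\<in>fsyms \<L>. \<forall>xs. length xs = farity \<L> f \<longrightarrow> set xs \<subseteq> carr S \<longrightarrow> fint S f xs \<in> carr S) \<and>
     (\<Union>D\<in>dsyms \<L>. dint S D) = carr S \<and>
     (\<forall>D\<in>dsyms \<L>. Metric_space.mcomplete (dint S D) (metr S) \<and>
                  Metric_space.mbounded (carr S) (metr S) (dint S D)) \<and>
     uniformly_cont \<L> S"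

text \<open>The substructure generated by X; it contains the constants even if X is empty.\<close>

definition generated :: "('f, 'g, 'i) lang \<Rightarrow> ('a, 'f, 'g, 'i) struct \<Rightarrow> 'a set \<Rightarrow> 'a set" where
  "generated \<L> S X = {eval S xs t | n t xs. t \<in> terms \<L> n \<and> length xs = n \<and> set xs \<subseteq> X}"

definition top_generating :: "('f, 'g, 'i) lang \<Rightarrow> ('a, 'f, 'g, 'i) struct \<Rightarrow> 'a set \<Rightarrow> bool" where
  "top_generating \<L> S X \<longleftrightarrow>
     (\<forall>\<epsilon>>0. \<forall>x\<in>carr S. \<exists>y\<in>generated \<L> S X.
        metr S x y < \<epsilon> \<and> (\<forall>D\<in>dsyms \<L>. x \<in> dint S D \<longrightarrow> y \<in> dint S D))"

definition metric_symbol_in :: "('f, 'g, 'i) lang \<Rightarrow> 'g \<Rightarrow> ('a, 'f, 'g, 'i) struct \<Rightarrow> bool" where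
  "metric_symbol_in \<L> g S \<longleftrightarrow>
     garity \<L> g = 2 \<and> (\<forall>x\<in>carr S. \<forall>y\<in>carr S. gint S g [x, y] = metr S x y)"

definition microstate ::
  "('f, 'g, 'i) lang \<Rightarrow> ('a, 'f, 'g, 'i) struct \<Rightarrow> ('b, 'f, 'g, 'i) struct \<Rightarrow>
   'a set \<Rightarrow> ('f, 'g) symb set \<Rightarrow> real \<Rightarrow> ('a \<Rightarrow> 'b) \<Rightarrow> bool" where
  "microstate \<L> A B F R \<delta> \<sigma> \<longleftrightarrow>
     (\<forall>n t xs y. TermSym n t \<in> R \<longrightarrow> length xs = n \<longrightarrow> set xs \<subseteq> F \<longrightarrow> y \<in> F \<longrightarrow> y = eval A xs t \<longrightarrow>
        metr B (\<sigma> y) (eval B (map \<sigma> xs) t) \<le> \<delta>) \<and>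
     (\<forall>g xs. StateSym g \<in> R \<longrightarrow> length xs = garity \<L> g \<longrightarrow> set xs \<subseteq> F \<longrightarrow>
        \<bar>gint A g xs - gint B g (map \<sigma> xs)\<bar> \<le> \<delta>)"

definition domain_preserving ::
  "('f, 'g, 'i) lang \<Rightarrow> ('a, 'f, 'g, 'i) struct \<Rightarrow> ('b, 'f, 'g, 'i) struct \<Rightarrow>
   'a set \<Rightarrow> ('a \<Rightarrow> 'b) \<Rightarrow> bool" where
  "domain_preserving \<L> A B F \<sigma> \<longleftrightarrow>
     (\<forall>a\<in>F. \<forall>D\<in>dsyms \<L>. a \<in> dint A D \<longrightarrow> \<sigma> a \<in> dint B D)"

definition almost_contractive ::
  "('a, 'f, 'g, 'i) struct \<Rightarrow> ('b, 'f, 'g, 'i) struct \<Rightarrow> 'a set \<Rightarrow> real \<Rightarrow> ('a \<Rightarrow> 'b) \<Rightarrow> bool" where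
  "almost_contractive A B F \<delta> \<sigma> \<longleftrightarrow>
     (\<forall>a\<in>F. \<forall>b\<in>F. metr B (\<sigma> a) (\<sigma> b) \<le> metr A a b + \<delta>)"

definition MS ::
  "('f, 'g, 'i) lang \<Rightarrow> ('a, 'f, 'g, 'i) struct \<Rightarrow> ('b, 'f, 'g, 'i) struct \<Rightarrow>
   'a set \<Rightarrow> ('f, 'g) symb set \<Rightarrow> real \<Rightarrow> ('a \<Rightarrow> 'b) set" where
  "MS \<L> A B F R \<delta> =
     {\<sigma> \<in> F \<rightarrow>\<^sub>E carr B. microstate \<L> A B F R \<delta> \<sigma> \<and> domain_preserving \<L> A B F \<sigma>}"

definition CMS ::
  "('f, 'g, 'i) lang \<Rightarrow> ('a, 'f, 'g, 'i) struct \<Rightarrow> ('b, 'f, 'g, 'i) struct \<Rightarrow>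
   'a set \<Rightarrow> ('f, 'g) symb set \<Rightarrow> real \<Rightarrow> ('a \<Rightarrow> 'b) set" where
  "CMS \<L> A B F R \<delta> = {\<sigma> \<in> MS \<L> A B F R \<delta>. almost_contractive A B F \<delta> \<sigma>}"

text \<open>Inserting 0 only matters for empty E, where the supremum of distances is read as 0.\<close>

definition map_dist ::
  "('b, 'f, 'g, 'i) struct \<Rightarrow> 'a set \<Rightarrow> ('a \<Rightarrow> 'b) \<Rightarrow> ('a \<Rightarrow> 'b) \<Rightarrow> real" where
  "map_dist B E \<sigma> \<tau> = Sup (insert 0 ((\<lambda>s. metr B (\<sigma> s) (\<tau> s)) ` E))"

definition separated ::
  "('b, 'f, 'g, 'i) struct \<Rightarrow> 'a set \<Rightarrow> real \<Rightarrow> ('a \<Rightarrow> 'b) set \<Rightarrow> bool" where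
  "separated B E \<epsilon> X \<longleftrightarrow> (\<forall>\<sigma>\<in>X. \<forall>\<tau>\<in>X. \<sigma> \<noteq> \<tau> \<longrightarrow> map_dist B E \<sigma> \<tau> \<ge> \<epsilon>)"

text \<open>The value is infinite if there are arbitrarily large finite separated subsets.\<close>

definition sep_number ::
  "('b, 'f, 'g, 'i) struct \<Rightarrow> 'a set \<Rightarrow> real \<Rightarrow> ('a \<Rightarrow> 'b) set \<Rightarrow> enat" where
  "sep_number B E \<epsilon> Y = (SUP X\<in>{X. X \<subseteq> Y \<and> finite X \<and> separated B E \<epsilon> X}. enat (card X))"

definition elog :: "enat \<Rightarrow> ereal" where
  "elog m = (case m of enat k \<Rightarrow> (if k = 0 then -\<infinity> else ereal (ln (real k))) | \<infinity> \<Rightarrow> \<infinity>)"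

text \<open>
  The argument \<open>\<Phi>\<close> below is the microstate space used, to be instantiated with \<open>MS\<close> or \<open>CMS\<close>.
\<close>

type_synonym ('a, 'b, 'f, 'g, 'i) microstate_space =
  "('f, 'g, 'i) lang \<Rightarrow> ('a, 'f, 'g, 'i) struct \<Rightarrow> ('b, 'f, 'g, 'i) struct \<Rightarrow>
   'a set \<Rightarrow> ('f, 'g) symb set \<Rightarrow> real \<Rightarrow> ('a \<Rightarrow> 'b) set"

definition entropy_approx ::
  "('a, 'b, 'f, 'g, 'i) microstate_space \<Rightarrow> ('f, 'g, 'i) lang \<Rightarrow> ('a, 'f, 'g, 'i) struct \<Rightarrow>
   (nat \<Rightarrow> ('b, 'f, 'g, 'i) struct) \<Rightarrow> (nat \<Rightarrow> real) \<Rightarrow>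
   'a set \<Rightarrow> 'a set \<Rightarrow> ('f, 'g) symb set \<Rightarrow> real \<Rightarrow> real \<Rightarrow> ereal" where
  "entropy_approx \<Phi> \<L> A As N E F R \<delta> \<epsilon> =
     limsup (\<lambda>r. elog (sep_number (As r) E \<epsilon> (\<Phi> \<L> A (As r) F R \<delta>)) / ereal (N r))"

definition entropy_at ::
  "('a, 'b, 'f, 'g, 'i) microstate_space \<Rightarrow> ('f, 'g, 'i) lang \<Rightarrow> ('a, 'f, 'g, 'i) struct \<Rightarrow>
   (nat \<Rightarrow> ('b, 'f, 'g, 'i) struct) \<Rightarrow> (nat \<Rightarrow> real) \<Rightarrow> 'a set \<Rightarrow> 'a set \<Rightarrow> real \<Rightarrow> ereal" where
  "entropy_at \<Phi> \<L> A As N E B \<epsilon> =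
     (INF \<delta>\<in>{0<..}. INF R\<in>{R. finite R \<and> R \<subseteq> symbols \<L>}. INF F\<in>{F. E \<subseteq> F \<and> finite F \<and> F \<subseteq> B}.
        entropy_approx \<Phi> \<L> A As N E F R \<delta> \<epsilon>)"

definition entropy ::
  "('a, 'b, 'f, 'g, 'i) microstate_space \<Rightarrow> ('f, 'g, 'i) lang \<Rightarrow> ('a, 'f, 'g, 'i) struct \<Rightarrow>
   (nat \<Rightarrow> ('b, 'f, 'g, 'i) struct) \<Rightarrow> (nat \<Rightarrow> real) \<Rightarrow> 'a set \<Rightarrow> ereal" where
  "entropy \<Phi> \<L> A As N G =
     (SUP E\<in>{E. finite E \<and> E \<subseteq> G}. SUP \<epsilon>\<in>{0<..}. entropy_at \<Phi> \<L> A As N E (generated \<L> A G) \<epsilon>)"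

definition entropy_dim ::
  "('a, 'b, 'f, 'g, 'i) microstate_space \<Rightarrow> ('f, 'g, 'i) lang \<Rightarrow> ('a, 'f, 'g, 'i) struct \<Rightarrow>
   (nat \<Rightarrow> ('b, 'f, 'g, 'i) struct) \<Rightarrow> (nat \<Rightarrow> real) \<Rightarrow> (real \<Rightarrow> real) \<Rightarrow> 'a set \<Rightarrow> ereal" where
  "entropy_dim \<Phi> \<L> A As N L G =
     (SUP E\<in>{E. finite E \<and> E \<subseteq> G}.
        Limsup (at_right 0) (\<lambda>\<epsilon>. entropy_at \<Phi> \<L> A As N E (generated \<L> A G) \<epsilon> / ereal (L \<epsilon>)))"

end

theory Submission
  imports Defs
begin

text \<open>
  If the elements of E are values of terms at a finite list of generators, then an almost exact
  microstate is determined on E, up to a small error, by its values at the generators. Hence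
  separation on E forces separation on the generators, with the scale distorted by a modulus of
  continuity. The growth condition on L makes this distortion invisible to the dimension, and the
  entropy does not see it at all.

  If G only generates topologically, choose for each point a a nearby point \<open>\<psi> a\<close> of the
  generated substructure lying in all the domains of a. Contractivity of a microstate \<open>\<sigma>\<close> of the
  substructure makes \<open>\<sigma> \<circ> \<psi>\<close> a microstate: \<open>\<psi> (t a)\<close> and \<open>t (\<psi> a)\<close>
  are close but distinct, so it is needed that \<open>\<sigma>\<close> takes close values there. If the metric is a
  state symbol, then contractivity is part of the microstate condition.
\<close>

section \<open>Structures, terms and generated substructures\<close>

lemma struct_of_metric: "struct_of \<L> S \<Longrightarrow> Metric_space (carr S) (metr S)"
  by (simp add: struct_of_def)

lemma dint_subset_carr: "struct_of \<L> S \<Longrightarrow> D \<in> dsyms \<L> \<Longrightarrow> dint S D \<subseteq> carr S"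
  by (auto simp: struct_of_def)

text \<open>Moduli are indexed by tuples of domains, so they become usable at given points only
  after domains containing these points are fixed. Such domains exist because they exhaust the
  carrier.\<close>

lemma obtain_domain_tuple:
  assumes "struct_of \<L> S" "set xs \<subseteq> carr S"
  obtains Ds where "Ds \<in> dom_tuples \<L> (length xs)" "\<And>i. i < length xs \<Longrightarrow> xs ! i \<in> dint S (Ds ! i)"
proof -
  have "\<forall>x\<in>carr S. \<exists>D\<in>dsyms \<L>. x \<in> dint S D"
    using assms(1) by (auto simp: struct_of_def)
  then obtain D where D: "\<And>x. x \<in> carr S \<Longrightarrow> D x \<in> dsyms \<L> \<and> x \<in> dint S (D x)"
    by metis
  show thesis
    by (rule that[of "map D xs"]) (use D nth_mem assms(2) in \<open>force simp: dom_tuples_def\<close>)+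
qed

lemma eval_in_carr:
  assumes "struct_of \<L> S" "t \<in> terms \<L> (length xs)" "set xs \<subseteq> carr S"
  shows "eval S xs t \<in> carr S"
  using assms(2)
proof induction
  case (Var i)
  then show ?case using assms(3) by auto
next
  case (Fun f ts)
  then show ?case using assms(1) by (auto simp: struct_of_def image_subset_iff)
qed

lemma generated_subset_carr:
  "struct_of \<L> S \<Longrightarrow> X \<subseteq> carr S \<Longrightarrow> generated \<L> S X \<subseteq> carr S"
  by (auto simp: generated_def intro: eval_in_carr)

lemma subset_generated: "X \<subseteq> generated \<L> S X"
proof
  fix x assume "x \<in> X"
  then show "x \<in> generated \<L> S X"
    unfolding generated_def
    by (intro CollectI exI[of _ 1] exI[of _ "Var 0"] exI[of _ "[x]"]) (auto intro: terms.Var)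
qed

lemma generated_carr: "struct_of \<L> S \<Longrightarrow> generated \<L> S (carr S) = carr S"
  by (simp add: generated_subset_carr subset_antisym subset_generated)

primrec subst :: "'f trm list \<Rightarrow> 'f trm \<Rightarrow> 'f trm" where
  "subst ss (Var i) = ss ! i"
| "subst ss (Fun f ts) = Fun f (map (subst ss) ts)"

lemma subst_in_terms:
  assumes "t \<in> terms \<L> (length ss)" "set ss \<subseteq> terms \<L> m"
  shows "subst ss t \<in> terms \<L> m"
  using assms(1)
proof induction
  case (Var i)
  then show ?case using assms(2) by auto
next
  case (Fun f ts)
  then show ?case by (auto intro!: terms.Fun)
qed

lemma eval_subst:
  assumes "t \<in> terms \<L> (length ss)"
  shows "eval S xs (subst ss t) = eval S (map (eval S xs) ss) t"
  using assms
proof induction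
  case (Fun f ts)
  then show ?case by (auto intro!: arg_cong[where f = "fint S f"])
qed simp

text \<open>Each element is a term value at its own argument list. Merging these finitely many lists
  into one and renaming the variables gives a common list, so that a microstate on \<open>E\<close>
  can be controlled by its values at one tuple of generators.\<close>

lemma finite_subset_generated:
  assumes "finite E" "E \<subseteq> generated \<L> S X"
  obtains xs t where "set xs \<subseteq> X" "X \<noteq> {} \<Longrightarrow> xs \<noteq> []"
    "\<And>e. e \<in> E \<Longrightarrow> t e \<in> terms \<L> (length xs)" "\<And>e. e \<in> E \<Longrightarrow> e = eval S xs (t e)"
proof -
  have "\<forall>e\<in>E. \<exists>ys t. e = eval S ys t \<and> t \<in> terms \<L> (length ys) \<and> set ys \<subseteq> X"
    using assms(2) by (fastforce simp: generated_def)
  then obtain ys u where yu: "\<And>e. e \<in> E \<Longrightarrow>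
      e = eval S (ys e) (u e) \<and> u e \<in> terms \<L> (length (ys e)) \<and> set (ys e) \<subseteq> X"
    by metis
  \<comment> \<open>The last set adds some element of \<open>X\<close>, which makes the common list
    nonempty as soon as \<open>X\<close> is.\<close>
  define Y where "Y = (\<Union>e\<in>E. set (ys e)) \<union> (if X = {} then {} else {SOME x. x \<in> X})"
  have "finite Y" using assms(1) by (auto simp: Y_def)
  then obtain xs where xs: "set xs = Y" using finite_list by blast
  have YX: "Y \<subseteq> X" using yu by (auto simp: Y_def some_in_eq)
  have "\<forall>y\<in>Y. \<exists>i<length xs. xs ! i = y" using xs by (metis in_set_conv_nth)
  then obtain ix where ix: "\<And>y. y \<in> Y \<Longrightarrow> ix y < length xs \<and> xs ! ix y = y" by metis
  \<comment> \<open>Variable j of \<open>u e\<close> is renamed to a position in \<open>xs\<close>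
    that holds the j-th entry of \<open>ys e\<close>.\<close>
  define t where "t e = subst (map (\<lambda>y. Var (ix y)) (ys e)) (u e)" for e
  have sub: "set (ys e) \<subseteq> Y" if "e \<in> E" for e using that by (auto simp: Y_def)
  show thesis
  proof (rule that[of xs t])
    show "set xs \<subseteq> X" using xs YX by simp
    show "xs \<noteq> []" if "X \<noteq> {}" using that xs by (auto simp: Y_def)
    fix e assume e: "e \<in> E"
    show "t e \<in> terms \<L> (length xs)"
      unfolding t_def using yu[OF e] sub[OF e] ix by (intro subst_in_terms) (auto intro!: terms.Var)
    have "map (eval S xs) (map (\<lambda>y. Var (ix y)) (ys e)) = ys e"
      using sub[OF e] ix by (intro nth_equalityI) (auto simp: subset_iff)
    then show "e = eval S xs (t e)"
      unfolding t_def using yu[OF e] by (subst eval_subst[where \<L> = \<L>]) (auto simp: comp_def)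
  qed
qed

text \<open>Once the arguments are written as term values at one common list, substitution turns the
  composite into a single term at that list.\<close>

lemma eval_in_generated:
  assumes "t \<in> terms \<L> (length zs)" "set zs \<subseteq> generated \<L> S X"
  shows "eval S zs t \<in> generated \<L> S X"
proof -
  obtain xs u where xu: "set xs \<subseteq> X" "\<And>e. e \<in> set zs \<Longrightarrow> u e \<in> terms \<L> (length xs)"
    "\<And>e. e \<in> set zs \<Longrightarrow> e = eval S xs (u e)"
    using finite_subset_generated[OF _ assms(2)] by (metis List.finite_set)
  have "map (eval S xs) (map u zs) = zs"
    by (intro nth_equalityI) (use xu(3) in auto)
  then have "eval S xs (subst (map u zs) t) = eval S zs t"
    using assms(1) by (subst eval_subst[where \<L> = \<L>]) auto
  moreover have "subst (map u zs) t \<in> terms \<L> (length xs)"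
    using assms(1) xu(2) by (intro subst_in_terms) auto
  ultimately show ?thesis
    using xu(1) unfolding generated_def by (metis (mono_tags, lifting) mem_Collect_eq)
qed

section \<open>Moduli of continuity in several variables\<close>

lemma modulus_bounds:
  assumes "language \<L>" "s \<in> symbols \<L>" "Ds \<in> dom_tuples \<L> (arity \<L> s)" "arity \<L> s > 0"
    "0 < \<epsilon>" "\<epsilon> \<le> 1"
  shows "0 < modulus \<L> s Ds \<epsilon>" "modulus \<L> s Ds \<epsilon> \<le> 1"
  using assms by (auto simp: language_def image_subset_iff)

lemma value_dist_triangle:
  assumes "struct_of \<L> S" "s \<in> symbols \<L>"
    "length xs = arity \<L> s" "length ys = arity \<L> s" "length zs = arity \<L> s"
    "set xs \<subseteq> carr S" "set ys \<subseteq> carr S" "set zs \<subseteq> carr S"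
  shows "value_dist S s xs zs \<le> value_dist S s xs ys + value_dist S s ys zs"
proof (cases s)
  case (TermSym n t)
  then have "t \<in> terms \<L> n" using assms(2) by (auto simp: symbols_def)
  then show ?thesis
    using TermSym assms eval_in_carr[OF assms(1)] Metric_space.triangle[OF struct_of_metric[OF assms(1)]]
    by simp
qed simp

text \<open>The given moduli control one coordinate at a time, so the coordinates are exchanged in turn.\<close>

lemma value_dist_le:
  assumes S: "struct_of \<L> S" and s: "s \<in> symbols \<L>" and n: "arity \<L> s = n"
    and len: "length xs = n" "length ys = n" and Ds: "Ds \<in> dom_tuples \<L> n"
    and xs: "\<And>i. i < n \<Longrightarrow> xs ! i \<in> dint S (Ds ! i)"
    and ys: "\<And>i. i < n \<Longrightarrow> ys ! i \<in> dint S (Ds ! i)"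
    and \<epsilon>: "0 < \<epsilon>" "\<epsilon> \<le> 1"
    and close: "\<And>i. i < n \<Longrightarrow> metr S (xs ! i) (ys ! i) < modulus \<L> s Ds \<epsilon>"
  shows "value_dist S s xs ys \<le> n * \<epsilon>"
proof -
  interpret Metric_space "carr S" "metr S" by (rule struct_of_metric[OF S])
  have dcar: "dint S (Ds ! i) \<subseteq> carr S" if "i < n" for i
    using dint_subset_carr[OF S] Ds that by (force simp: dom_tuples_def)
  \<comment> \<open>Hybrid lists: the first \<open>k\<close> entries come from \<open>ys\<close>,
    the others from \<open>xs\<close>, so that \<open>z 0\<close> is \<open>xs\<close> and
    \<open>z n\<close> is \<open>ys\<close>.\<close>
  define z where "z k = map (\<lambda>i. if i < k then ys ! i else xs ! i) [0..<n]" for k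
  have zl: "length (z k) = n" for k by (simp add: z_def)
  have zn: "z k ! i = (if i < k then ys ! i else xs ! i)" if "i < n" for k i
    using that by (simp add: z_def)
  have zc: "set (z k) \<subseteq> carr S" for k
    using xs ys dcar by (fastforce simp: z_def)
  have "value_dist S s xs (z k) \<le> k * \<epsilon>" if "k \<le> n" for k
    using that
  proof (induction k)
    case 0
    have z0: "z 0 = xs" by (intro nth_equalityI) (auto simp: zl zn len)
    show ?case
    proof (cases s)
      case (TermSym m t)
      then have "eval S xs t \<in> carr S"
        using s n len zc[of 0] z0 eval_in_carr[OF S] by (auto simp: symbols_def)
      then show ?thesis using TermSym z0 by simp
    qed (simp add: z0)
  next
    case (Suc k)
    have k: "k < n" using Suc by simp
    \<comment> \<open>Uniform continuity speaks of two updates of one list at one position, so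
      consecutive hybrids are both written as updates of \<open>z k\<close> at position
      \<open>k\<close>.\<close>
    have e1: "(z k)[k := xs ! k] = z k"
      by (intro nth_equalityI) (auto simp: zl zn nth_list_update)
    have e2: "(z k)[k := ys ! k] = z (Suc k)"
      by (intro nth_equalityI) (auto simp: zl zn nth_list_update less_Suc_eq)
    have "\<forall>i<n. i \<noteq> k \<longrightarrow> z k ! i \<in> dint S (Ds ! i)"
      using xs ys by (auto simp: zn)
    then have "value_dist S s ((z k)[k := xs ! k]) ((z k)[k := ys ! k]) < \<epsilon>"
      using S s n Ds k xs ys close \<epsilon> zl unfolding struct_of_def uniformly_cont_def by blast
    then have "value_dist S s (z k) (z (Suc k)) < \<epsilon>" by (simp only: e1 e2)
    moreover have "value_dist S s xs (z (Suc k)) \<le> value_dist S s xs (z k) + value_dist S s (z k) (z (Suc k))"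
    proof (rule value_dist_triangle[OF S s])
      have "z 0 = xs" by (intro nth_equalityI) (auto simp: zl zn len)
      then show "set xs \<subseteq> carr S" using zc[of 0] by simp
    qed (auto simp: zl n len zc[THEN subsetD])
    ultimately show ?case using Suc by (simp add: algebra_simps)
  qed
  from this[of n] have "value_dist S s xs (z n) \<le> n * \<epsilon>" by simp
  moreover have "z n = ys" by (intro nth_equalityI) (auto simp: zl zn len)
  ultimately show ?thesis by simp
qed

section \<open>Separation numbers and comparison of entropies\<close>

lemma map_dist_less_iff:
  assumes "finite E" "0 < \<epsilon>"
  shows "map_dist B E \<sigma> \<tau> < \<epsilon> \<longleftrightarrow> (\<forall>s\<in>E. metr B (\<sigma> s) (\<tau> s) < \<epsilon>)"
  unfolding map_dist_def using assms by (subst cSup_eq_Max) auto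

text \<open>By the contrapositive of \<open>close\<close>, \<open>\<Psi>\<close> carries a separated
  set to a separated set. It is injective there: two distinct maps with the same image would have
  images at distance less than \<open>\<epsilon>'\<close> by \<open>zero\<close>, hence would be too
  close themselves. So cardinalities are kept.\<close>

lemma sep_number_le:
  assumes \<Psi>: "\<And>\<sigma>. \<sigma> \<in> Y \<Longrightarrow> \<Psi> \<sigma> \<in> Y'"
    and close: "\<And>\<sigma> \<tau>. \<sigma> \<in> Y \<Longrightarrow> \<tau> \<in> Y \<Longrightarrow> map_dist B E' (\<Psi> \<sigma>) (\<Psi> \<tau>) < \<epsilon>' \<Longrightarrow> map_dist B E \<sigma> \<tau> < \<epsilon>"
    and zero: "\<And>\<sigma>. \<sigma> \<in> Y \<Longrightarrow> map_dist B E' (\<Psi> \<sigma>) (\<Psi> \<sigma>) < \<epsilon>'"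
  shows "sep_number B E \<epsilon> Y \<le> sep_number B E' \<epsilon>' Y'"
  unfolding sep_number_def
proof (rule SUP_least)
  fix X assume "X \<in> {X. X \<subseteq> Y \<and> finite X \<and> separated B E \<epsilon> X}"
  then have X: "X \<subseteq> Y" "finite X" "separated B E \<epsilon> X" by auto
  have far: "\<not> map_dist B E' (\<Psi> \<sigma>) (\<Psi> \<tau>) < \<epsilon>'" if "\<sigma> \<in> X" "\<tau> \<in> X" "\<sigma> \<noteq> \<tau>" for \<sigma> \<tau>
    using X that close by (meson not_le separated_def subset_iff)
  have inj: "inj_on \<Psi> X"
  proof (rule inj_onI, rule ccontr)
    fix \<sigma> \<tau> assume *: "\<sigma> \<in> X" "\<tau> \<in> X" "\<Psi> \<sigma> = \<Psi> \<tau>" "\<sigma> \<noteq> \<tau>"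
    then show False using far[of \<sigma> \<tau>] zero[of \<sigma>] X by auto
  qed
  have "separated B E' \<epsilon>' (\<Psi> ` X)"
    unfolding separated_def using far by (force simp: not_less)
  then have "\<Psi> ` X \<in> {X. X \<subseteq> Y' \<and> finite X \<and> separated B E' \<epsilon>' X}"
    using X \<Psi> by auto
  from SUP_upper[OF this, of "\<lambda>X. enat (card X)"]
  show "enat (card X) \<le> (SUP X\<in>{X. X \<subseteq> Y' \<and> finite X \<and> separated B E' \<epsilon>' X}. enat (card X))"
    using card_image[OF inj] by simp
qed

lemma elog_mono: "m \<le> n \<Longrightarrow> elog m \<le> elog n"
  by (cases m; cases n) (auto simp: elog_def)

text \<open>The right side is an infimum, so each choice of its parameters has to be matched by a
  choice on the left with no larger separation numbers. Only \<open>r \<ge> 1\<close> is considered,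
  where \<open>N r\<close> is positive; the upper limit does not see \<open>r = 0\<close>.\<close>

lemma entropy_at_le:
  assumes N: "\<And>r. r \<ge> 1 \<Longrightarrow> N r > 0"
    and *: "\<And>\<delta>' R' F'. \<delta>' > 0 \<Longrightarrow> finite R' \<Longrightarrow> R' \<subseteq> symbols \<L> \<Longrightarrow> E' \<subseteq> F' \<Longrightarrow> finite F' \<Longrightarrow> F' \<subseteq> B' \<Longrightarrow>
      \<exists>\<delta>>0. \<exists>R F. finite R \<and> R \<subseteq> symbols \<L> \<and> E \<subseteq> F \<and> finite F \<and> F \<subseteq> B \<and>
        (\<forall>r\<ge>1. sep_number (As r) E \<epsilon> (\<Phi> \<L> A (As r) F R \<delta>)
              \<le> sep_number (As r) E' \<epsilon>' (\<Phi>' \<L> A (As r) F' R' \<delta>'))"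
  shows "entropy_at \<Phi> \<L> A As N E B \<epsilon> \<le> entropy_at \<Phi>' \<L> A As N E' B' \<epsilon>'"
  unfolding entropy_at_def[of \<Phi>' \<L> A As N E' B' \<epsilon>']
proof (intro INF_greatest)
  fix \<delta>' R' F'
  assume "\<delta>' \<in> {0::real<..}" "R' \<in> {R. finite R \<and> R \<subseteq> symbols \<L>}" "F' \<in> {F. E' \<subseteq> F \<and> finite F \<and> F \<subseteq> B'}"
  with *[of \<delta>' R' F'] obtain \<delta> R F where
    \<delta>: "\<delta> > 0" "finite R" "R \<subseteq> symbols \<L>" "E \<subseteq> F" "finite F" "F \<subseteq> B"
    and le: "\<And>r. r \<ge> 1 \<Longrightarrow> sep_number (As r) E \<epsilon> (\<Phi> \<L> A (As r) F R \<delta>)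
              \<le> sep_number (As r) E' \<epsilon>' (\<Phi>' \<L> A (As r) F' R' \<delta>')"
    by auto
  have "entropy_at \<Phi> \<L> A As N E B \<epsilon> \<le> entropy_approx \<Phi> \<L> A As N E F R \<delta> \<epsilon>"
    unfolding entropy_at_def using \<delta>
    by (intro INF_lower2[of \<delta>] INF_lower2[of R] INF_lower2[of F]) auto
  also have "\<dots> \<le> entropy_approx \<Phi>' \<L> A As N E' F' R' \<delta>' \<epsilon>'"
    unfolding entropy_approx_def
  proof (rule Limsup_mono)
    show "\<forall>\<^sub>F r in sequentially. elog (sep_number (As r) E \<epsilon> (\<Phi> \<L> A (As r) F R \<delta>)) / ereal (N r)
        \<le> elog (sep_number (As r) E' \<epsilon>' (\<Phi>' \<L> A (As r) F' R' \<delta>')) / ereal (N r)"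
      using eventually_ge_at_top[of 1]
      by eventually_elim (use N le in \<open>auto intro!: ereal_divide_right_mono elog_mono\<close>)
  qed
  finally show "entropy_at \<Phi> \<L> A As N E B \<epsilon> \<le> entropy_approx \<Phi>' \<L> A As N E' F' R' \<delta>' \<epsilon>'" .
qed

section \<open>Restriction of microstates to fewer points and weaker conditions\<close>

lemma MS_restrict:
  assumes "\<sigma> \<in> MS \<L> A B F R \<delta>" "F' \<subseteq> F" "R' \<subseteq> R" "\<delta> \<le> \<delta>'"
  shows "restrict \<sigma> F' \<in> MS \<L> A B F' R' \<delta>'"
proof -
  have ms: "microstate \<L> A B F R \<delta> \<sigma>" "domain_preserving \<L> A B F \<sigma>" "\<sigma> \<in> F \<rightarrow>\<^sub>E carr B"
    using assms(1) by (auto simp: MS_def)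
  have map: "map (restrict \<sigma> F') xs = map \<sigma> xs" if "set xs \<subseteq> F'" for xs
    using that by auto
  have "microstate \<L> A B F' R' \<delta>' (restrict \<sigma> F')"
    unfolding microstate_def
  proof (intro conjI allI impI)
    fix n t xs y
    assume *: "TermSym n t \<in> R'" "length xs = n" "set xs \<subseteq> F'" "y \<in> F'" "y = eval A xs t"
    then have "metr B (\<sigma> y) (eval B (map \<sigma> xs) t) \<le> \<delta>"
      using ms(1) assms(2,3) unfolding microstate_def by blast
    then show "metr B (restrict \<sigma> F' y) (eval B (map (restrict \<sigma> F') xs) t) \<le> \<delta>'"
      using * assms(4) by (simp only: map) simp
  next
    fix g xs
    assume *: "StateSym g \<in> R'" "length xs = garity \<L> g" "set xs \<subseteq> F'"
    then have "\<bar>gint A g xs - gint B g (map \<sigma> xs)\<bar> \<le> \<delta>"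
      using ms(1) assms(2,3) unfolding microstate_def by blast
    then show "\<bar>gint A g xs - gint B g (map (restrict \<sigma> F') xs)\<bar> \<le> \<delta>'"
      using * assms(4) by (simp only: map)
  qed
  then show ?thesis
    using ms assms(2) by (auto simp: MS_def domain_preserving_def)
qed

text \<open>Carrying both spaces along as one variable \<open>\<Phi>\<close> lets the later
  comparison of scales serve the dimension as well as the entropy.\<close>

lemma microstate_space_restrict:
  assumes "\<Phi> = MS \<or> \<Phi> = CMS" "\<sigma> \<in> \<Phi> \<L> A B F R \<delta>" "F' \<subseteq> F" "R' \<subseteq> R" "\<delta> \<le> \<delta>'"
  shows "restrict \<sigma> F' \<in> \<Phi> \<L> A B F' R' \<delta>'"
  using assms(1)
proof
  assume "\<Phi> = MS"
  then show ?thesis using assms by (simp add: MS_restrict)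
next
  assume C: "\<Phi> = CMS"
  then have \<sigma>: "\<sigma> \<in> MS \<L> A B F R \<delta>" "almost_contractive A B F \<delta> \<sigma>"
    using assms(2) by (auto simp: CMS_def)
  then have "almost_contractive A B F' \<delta>' (restrict \<sigma> F')"
    unfolding almost_contractive_def using assms(3,5)
    by (metis add_left_mono order_trans restrict_apply' subset_iff)
  then show ?thesis using C MS_restrict[OF \<sigma>(1) assms(3-5)] by (simp add: CMS_def)
qed

lemma microstate_space_subset_MS: "\<Phi> = MS \<or> \<Phi> = CMS \<Longrightarrow> \<Phi> \<L> A B F R \<delta> \<subseteq> MS \<L> A B F R \<delta>"
  by (auto simp: CMS_def)

lemma map_dist_refl_less:
  assumes "struct_of \<L> B" "\<sigma> \<in> F \<rightarrow> carr B" "E \<subseteq> F" "finite E" "0 < \<epsilon>"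
  shows "map_dist B E \<sigma> \<sigma> < \<epsilon>"
proof -
  interpret Metric_space "carr B" "metr B" by (rule struct_of_metric[OF assms(1)])
  show ?thesis using assms by (auto simp: map_dist_less_iff Pi_iff subset_iff)
qed

text \<open>If closeness on \<open>E'\<close> forces closeness on \<open>E\<close> for all
  sufficiently good microstates, then restriction keeps separated sets separated. Given parameters
  on the right, the matching ones on the left add \<open>E\<close> to the points, add
  \<open>R0\<close> to the symbols and cap the tolerance at \<open>\<delta>0\<close>. The sets
  \<open>F\<close> on the left may range over a larger set \<open>C\<close>, which can only lower
  the infimum.\<close>

lemma entropy_at_le_restrict:
  assumes \<Phi>: "\<Phi> = MS \<or> \<Phi> = CMS"
    and A: "struct_of \<L> A" and As: "\<And>r. r \<ge> 1 \<Longrightarrow> struct_of \<L> (As r)"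
    and N: "\<And>r. r \<ge> 1 \<Longrightarrow> N r > 0"
    and "finite E" "finite E'" "E \<subseteq> C" "B \<subseteq> C"
    and "finite R0" "R0 \<subseteq> symbols \<L>" "\<delta>0 > 0" "\<epsilon>' > 0" "\<epsilon> > 0"
    and close: "\<And>r F R \<sigma> \<tau>. r \<ge> 1 \<Longrightarrow> E \<union> E' \<subseteq> F \<Longrightarrow> R0 \<subseteq> R \<Longrightarrow>
        \<sigma> \<in> \<Phi> \<L> A (As r) F R \<delta>0 \<Longrightarrow> \<tau> \<in> \<Phi> \<L> A (As r) F R \<delta>0 \<Longrightarrow>
        (\<And>s. s \<in> E' \<Longrightarrow> metr (As r) (\<sigma> s) (\<tau> s) < \<epsilon>') \<Longrightarrow>
        (\<And>s. s \<in> E \<Longrightarrow> metr (As r) (\<sigma> s) (\<tau> s) < \<epsilon>)"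
  shows "entropy_at \<Phi> \<L> A As N E C \<epsilon> \<le> entropy_at \<Phi> \<L> A As N E' B \<epsilon>'"
proof (rule entropy_at_le[OF N])
  fix \<delta>' :: real and R' F'
  assume p: "0 < \<delta>'" "finite R'" "R' \<subseteq> symbols \<L>" "E' \<subseteq> F'" "finite F'" "F' \<subseteq> B"
  let ?\<delta> = "min \<delta>' \<delta>0" and ?R = "R' \<union> R0" and ?F = "F' \<union> E"
  have "sep_number (As r) E \<epsilon> (\<Phi> \<L> A (As r) ?F ?R ?\<delta>) \<le> sep_number (As r) E' \<epsilon>' (\<Phi> \<L> A (As r) F' R' \<delta>')"
    if r: "r \<ge> 1" for r
  proof (rule sep_number_le[where \<Psi> = "\<lambda>\<sigma>. restrict \<sigma> F'"])
    fix \<sigma> assume \<sigma>: "\<sigma> \<in> \<Phi> \<L> A (As r) ?F ?R ?\<delta>"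
    show rest: "restrict \<sigma> F' \<in> \<Phi> \<L> A (As r) F' R' \<delta>'"
      by (rule microstate_space_restrict[OF \<Phi> \<sigma>]) auto
    have "restrict \<sigma> F' \<in> F' \<rightarrow> carr (As r)"
      using rest microstate_space_subset_MS[OF \<Phi>] by (fastforce simp: MS_def)
    then show "map_dist (As r) E' (restrict \<sigma> F') (restrict \<sigma> F') < \<epsilon>'"
      using As[OF r] p assms by (intro map_dist_refl_less) auto
    fix \<tau> assume \<tau>: "\<tau> \<in> \<Phi> \<L> A (As r) ?F ?R ?\<delta>"
      and d: "map_dist (As r) E' (restrict \<sigma> F') (restrict \<tau> F') < \<epsilon>'"
    \<comment> \<open>Microstates are extensional maps, so restriction to their own domain changes
      nothing. This lets the restriction lemma also express the mere loosening of the tolerance to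
      \<open>\<delta>0\<close>.\<close>
    have ext: "restrict \<rho> ?F = \<rho>" if "\<rho> \<in> \<Phi> \<L> A (As r) ?F ?R ?\<delta>" for \<rho>
      using that microstate_space_subset_MS[OF \<Phi>] by (fastforce simp: MS_def PiE_restrict)
    have up: "\<rho> \<in> \<Phi> \<L> A (As r) ?F ?R \<delta>0" if "\<rho> \<in> \<Phi> \<L> A (As r) ?F ?R ?\<delta>" for \<rho>
      using microstate_space_restrict[OF \<Phi> that, of ?F _ \<delta>0] ext[OF that] by simp
    have "metr (As r) (\<sigma> s) (\<tau> s) < \<epsilon>'" if "s \<in> E'" for s
      using d that p assms by (auto simp: map_dist_less_iff subset_iff)
    then have "metr (As r) (\<sigma> s) (\<tau> s) < \<epsilon>" if "s \<in> E" for s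
      using close[OF r _ _ up[OF \<sigma>] up[OF \<tau>] _ that] p by blast
    then show "map_dist (As r) E \<sigma> \<tau> < \<epsilon>" using assms by (auto simp: map_dist_less_iff)
  qed
  then show "\<exists>\<delta>>0. \<exists>R F. finite R \<and> R \<subseteq> symbols \<L> \<and> E \<subseteq> F \<and> finite F \<and> F \<subseteq> C \<and>
        (\<forall>r\<ge>1. sep_number (As r) E \<epsilon> (\<Phi> \<L> A (As r) F R \<delta>)
              \<le> sep_number (As r) E' \<epsilon>' (\<Phi> \<L> A (As r) F' R' \<delta>'))"
    using p assms by (intro exI[of _ ?\<delta>] conjI exI[of _ ?R] exI[of _ ?F]) auto
qed

text \<open>Maps that are close at the smaller scale are close at the larger one. This is the
  monotonicity that the comparison of upper limits requires.\<close>

lemma entropy_at_antimono: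
  assumes "\<Phi> = MS \<or> \<Phi> = CMS" "struct_of \<L> A" "\<And>r. r \<ge> 1 \<Longrightarrow> struct_of \<L> (As r)"
    "\<And>r. r \<ge> 1 \<Longrightarrow> N r > 0" "finite E" "E \<subseteq> B" "0 < \<epsilon>'" "\<epsilon>' \<le> \<epsilon>"
  shows "entropy_at \<Phi> \<L> A As N E B \<epsilon> \<le> entropy_at \<Phi> \<L> A As N E B \<epsilon>'"
proof (rule entropy_at_le_restrict[where ?R0.0 = "{}" and ?\<delta>0.0 = 1])
  fix r F R \<sigma> \<tau> s
  assume "\<And>s. s \<in> E \<Longrightarrow> metr (As r) (\<sigma> s) (\<tau> s) < \<epsilon>'" "s \<in> E"
  then show "metr (As r) (\<sigma> s) (\<tau> s) < \<epsilon>" using assms(8) by force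
qed (use assms in auto)

section \<open>Passage from term values to generators\<close>

text \<open>For a microstate, the image of \<open>e\<close> is within \<open>\<delta>0\<close> of
  the term \<open>t e\<close> at the images of \<open>xs\<close>. If two microstates are
  \<open>\<epsilon>'\<close>-close on \<open>xs\<close>, these term values differ by at most n times
  \<open>\<epsilon>0\<close>, where n is the length of \<open>xs\<close>. In total the images of
  \<open>e\<close> differ by at most \<open>2 * \<delta>0\<close> plus this amount. A modulus is
  involved only for nonempty \<open>xs\<close>, since the language bounds moduli only in positive
  arity.\<close>

lemma entropy_at_terms_le:
  assumes \<Phi>: "\<Phi> = MS \<or> \<Phi> = CMS"
    and A: "struct_of \<L> A" and As: "\<And>r. r \<ge> 1 \<Longrightarrow> struct_of \<L> (As r)"
    and N: "\<And>r. r \<ge> 1 \<Longrightarrow> N r > 0"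
    and E: "finite E" "E \<subseteq> C" and B: "B \<subseteq> C"
    and t: "\<And>e. e \<in> E \<Longrightarrow> t e \<in> terms \<L> (length xs)" "\<And>e. e \<in> E \<Longrightarrow> e = eval A xs (t e)"
    and Ds: "Ds \<in> dom_tuples \<L> (length xs)" "\<And>i. i < length xs \<Longrightarrow> xs ! i \<in> dint A (Ds ! i)"
    and \<epsilon>: "0 < \<epsilon>" "0 < \<epsilon>0" "\<epsilon>0 \<le> 1" "real (length xs) * \<epsilon>0 < \<epsilon>" "0 < \<epsilon>'"
    and mod: "\<And>e. e \<in> E \<Longrightarrow> xs \<noteq> [] \<Longrightarrow> \<epsilon>' \<le> modulus \<L> (TermSym (length xs) (t e)) Ds \<epsilon>0"
  shows "entropy_at \<Phi> \<L> A As N E C \<epsilon> \<le> entropy_at \<Phi> \<L> A As N (set xs) B \<epsilon>'"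
proof -
  let ?n = "length xs"
  \<comment> \<open>A quarter of the slack: two microstate errors use up half of it, which keeps the
    final inequality strict.\<close>
  define \<delta>0 where "\<delta>0 = (\<epsilon> - ?n * \<epsilon>0) / 4"
  have \<delta>0: "\<delta>0 > 0" "2 * \<delta>0 + ?n * \<epsilon>0 < \<epsilon>" using \<epsilon> by (auto simp: \<delta>0_def field_simps)
  have R0: "(\<lambda>e. TermSym ?n (t e)) ` E \<subseteq> symbols \<L>" using t by (auto simp: symbols_def)
  show ?thesis
  proof (rule entropy_at_le_restrict[OF \<Phi> A As N E(1) _ E(2) B _ R0 \<delta>0(1) \<epsilon>(5) \<epsilon>(1)])
    fix r F R \<sigma> \<tau> e
    assume r: "1 \<le> r" and F: "E \<union> set xs \<subseteq> F" and R: "(\<lambda>e. TermSym ?n (t e)) ` E \<subseteq> R"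
      and st: "\<sigma> \<in> \<Phi> \<L> A (As r) F R \<delta>0" "\<tau> \<in> \<Phi> \<L> A (As r) F R \<delta>0"
      and d: "\<And>s. s \<in> set xs \<Longrightarrow> metr (As r) (\<sigma> s) (\<tau> s) < \<epsilon>'" and e: "e \<in> E"
    interpret Metric_space "carr (As r)" "metr (As r)" by (rule struct_of_metric[OF As[OF r]])
    have ms: "metr (As r) (\<rho> e) (eval (As r) (map \<rho> xs) (t e)) \<le> \<delta>0"
      "\<And>i. i < ?n \<Longrightarrow> \<rho> (xs ! i) \<in> dint (As r) (Ds ! i)"
      "\<And>x. x \<in> F \<Longrightarrow> \<rho> x \<in> carr (As r)"
      if "\<rho> \<in> \<Phi> \<L> A (As r) F R \<delta>0" for \<rho>
    proof -
      have *: "microstate \<L> A (As r) F R \<delta>0 \<rho>" "domain_preserving \<L> A (As r) F \<rho>" "\<rho> \<in> F \<rightarrow>\<^sub>E carr (As r)"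
        using that microstate_space_subset_MS[OF \<Phi>] by (fastforce simp: MS_def)+
      have "TermSym ?n (t e) \<in> R" "set xs \<subseteq> F" "e \<in> F" using R F e by auto
      then show "metr (As r) (\<rho> e) (eval (As r) (map \<rho> xs) (t e)) \<le> \<delta>0"
        using *(1) t(2)[OF e] unfolding microstate_def by blast
      \<comment> \<open>Domain preservation is what makes the moduli for \<open>Ds\<close>, chosen
        in \<open>A\<close>, applicable to the image points in every \<open>As r\<close>.\<close>
      show "\<rho> (xs ! i) \<in> dint (As r) (Ds ! i)" if i: "i < ?n" for i
      proof -
        have "Ds ! i \<in> dsyms \<L>" using Ds(1) i by (auto simp: dom_tuples_def)
        moreover have "xs ! i \<in> F" using F i by auto
        ultimately show ?thesis using *(2) Ds(2)[OF i] unfolding domain_preserving_def by blast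
      qed
      show "\<And>x. x \<in> F \<Longrightarrow> \<rho> x \<in> carr (As r)" using *(3) by auto
    qed
    have "value_dist (As r) (TermSym ?n (t e)) (map \<sigma> xs) (map \<tau> xs) \<le> ?n * \<epsilon>0"
    proof (rule value_dist_le[OF As[OF r]])
      show "TermSym ?n (t e) \<in> symbols \<L>" using R0 e by auto
      fix i assume i: "i < ?n"
      then have "metr (As r) (\<sigma> (xs ! i)) (\<tau> (xs ! i)) < \<epsilon>'" using d by simp
      also have "\<epsilon>' \<le> modulus \<L> (TermSym ?n (t e)) Ds \<epsilon>0" using mod[OF e] i by (cases xs) auto
      finally show "metr (As r) (map \<sigma> xs ! i) (map \<tau> xs ! i) < modulus \<L> (TermSym ?n (t e)) Ds \<epsilon>0"
        using i by simp
    qed (use Ds \<epsilon> ms st in auto)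
    then have mid: "metr (As r) (eval (As r) (map \<sigma> xs) (t e)) (eval (As r) (map \<tau> xs) (t e)) \<le> ?n * \<epsilon>0"
      by simp
    have car: "eval (As r) (map \<rho> xs) (t e) \<in> carr (As r)" "\<rho> e \<in> carr (As r)"
      if "\<rho> \<in> \<Phi> \<L> A (As r) F R \<delta>0" for \<rho>
      using ms(3)[OF that] F e t(1)[OF e] by (auto intro!: eval_in_carr[OF As[OF r]] simp: subset_iff)
    \<comment> \<open>The path from the image of \<open>e\<close> under \<open>\<sigma>\<close> to
      that under \<open>\<tau>\<close> runs through the two term values at the images of
      \<open>xs\<close>.\<close>
    have "metr (As r) (\<sigma> e) (\<tau> e) \<le> metr (As r) (\<sigma> e) (eval (As r) (map \<sigma> xs) (t e))
        + metr (As r) (eval (As r) (map \<sigma> xs) (t e)) (\<tau> e)"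
      by (intro triangle car st)
    also have "metr (As r) (eval (As r) (map \<sigma> xs) (t e)) (\<tau> e)
        \<le> metr (As r) (eval (As r) (map \<sigma> xs) (t e)) (eval (As r) (map \<tau> xs) (t e))
        + metr (As r) (eval (As r) (map \<tau> xs) (t e)) (\<tau> e)"
      by (intro triangle car st)
    finally show "metr (As r) (\<sigma> e) (\<tau> e) < \<epsilon>"
      using mid ms(1)[OF st(1)] ms(1)[OF st(2)] \<delta>0(2) by (simp add: commute)
  qed (use E in auto)
qed

text \<open>The entropy takes a supremum over all scales, so any positive \<open>\<epsilon>'\<close>
  will do, however much smaller than \<open>\<epsilon>\<close> it is. The smallest of the finitely
  many moduli at \<open>\<epsilon>0\<close> is such a scale.\<close>

lemma entropy_at_generators_le:
  assumes \<Phi>: "\<Phi> = MS \<or> \<Phi> = CMS" and L: "language \<L>"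
    and A: "struct_of \<L> A" and As: "\<And>r. r \<ge> 1 \<Longrightarrow> struct_of \<L> (As r)"
    and N: "\<And>r. r \<ge> 1 \<Longrightarrow> N r > 0"
    and E: "finite E" "E \<subseteq> C" "E \<subseteq> generated \<L> A G" and B: "B \<subseteq> C" and G: "G \<subseteq> carr A" and \<epsilon>: "0 < \<epsilon>"
  obtains E' \<epsilon>' where "finite E'" "E' \<subseteq> G" "0 < \<epsilon>'"
    "entropy_at \<Phi> \<L> A As N E C \<epsilon> \<le> entropy_at \<Phi> \<L> A As N E' B \<epsilon>'"
proof -
  obtain xs t where xs: "set xs \<subseteq> G"
    and t: "\<And>e. e \<in> E \<Longrightarrow> t e \<in> terms \<L> (length xs)" "\<And>e. e \<in> E \<Longrightarrow> e = eval A xs (t e)"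
    using finite_subset_generated[OF E(1,3)] by metis
  obtain Ds where Ds: "Ds \<in> dom_tuples \<L> (length xs)" "\<And>i. i < length xs \<Longrightarrow> xs ! i \<in> dint A (Ds ! i)"
    using obtain_domain_tuple[OF A, of xs] xs G by blast
  let ?n = "length xs"
  \<comment> \<open>Dividing by \<open>?n + 1\<close> makes the total error strictly less than
    \<open>\<epsilon>\<close> and also covers an empty list; the bound 1 keeps
    \<open>\<epsilon>0\<close> in the range of arguments of a modulus.\<close>
  define \<epsilon>0 where "\<epsilon>0 = min 1 (\<epsilon> / (?n + 1))"
  have "?n * \<epsilon>0 \<le> ?n * (\<epsilon> / (?n + 1))" by (intro mult_left_mono) (auto simp: \<epsilon>0_def)
  also have "\<dots> < \<epsilon>" using \<epsilon> by (simp add: field_simps)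
  finally have \<epsilon>0: "0 < \<epsilon>0" "\<epsilon>0 \<le> 1" "?n * \<epsilon>0 < \<epsilon>" using \<epsilon> by (auto simp: \<epsilon>0_def)
  \<comment> \<open>Inserting 1 covers an empty \<open>E\<close>; for an empty list there is no
    modulus to respect.\<close>
  define \<epsilon>' where "\<epsilon>' = (if xs = [] then 1 else Min (insert 1 ((\<lambda>e. modulus \<L> (TermSym ?n (t e)) Ds \<epsilon>0) ` E)))"
  have \<epsilon>': "0 < \<epsilon>'"
    using E(1) modulus_bounds(1)[OF L] t Ds \<epsilon>0 by (auto simp: \<epsilon>'_def symbols_def)
  have mod: "\<epsilon>' \<le> modulus \<L> (TermSym ?n (t e)) Ds \<epsilon>0" if "e \<in> E" "xs \<noteq> []" for e
    using that E(1) by (auto simp: \<epsilon>'_def)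
  show thesis
    by (rule that[OF List.finite_set xs \<epsilon>' entropy_at_terms_le[OF \<Phi> A As N E(1,2) B t Ds \<epsilon> \<epsilon>0 \<epsilon>' mod]])
qed

section \<open>Topological generation and contractive microstates\<close>

lemma eventually_at_right_below: "0 < b \<Longrightarrow> \<forall>\<^sub>F x in at_right (0::real). x < b"
  by (rule eventually_at_rightI[of 0 b]) auto

text \<open>Contractivity bounds the distance of the images of \<open>e\<close> and
  \<open>\<psi> e\<close> by \<epsilon>/8 + \<epsilon>/16. Twice this plus \<epsilon>/2 is
  7\<epsilon>/8, so closeness at \<open>\<psi> e\<close> gives closeness at
  \<open>e\<close>.\<close>

lemma entropy_at_CMS_perturb:
  assumes A: "struct_of \<L> A" and As: "\<And>r. r \<ge> 1 \<Longrightarrow> struct_of \<L> (As r)"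
    and N: "\<And>r. r \<ge> 1 \<Longrightarrow> N r > 0"
    and E: "finite E" "E \<subseteq> C" "\<psi> ` E \<subseteq> C" and \<epsilon>: "0 < \<epsilon>"
    and \<psi>: "\<And>e. e \<in> E \<Longrightarrow> metr A e (\<psi> e) < \<epsilon> / 8"
  shows "entropy_at CMS \<L> A As N E C \<epsilon> \<le> entropy_at CMS \<L> A As N (\<psi> ` E) C (\<epsilon> / 2)"
proof (rule entropy_at_le_restrict[where ?R0.0 = "{}" and ?\<delta>0.0 = "\<epsilon> / 16"])
  fix r F R \<sigma> \<tau> e
  assume r: "1 \<le> r" and F: "E \<union> \<psi> ` E \<subseteq> F"
    and st: "\<sigma> \<in> CMS \<L> A (As r) F R (\<epsilon> / 16)" "\<tau> \<in> CMS \<L> A (As r) F R (\<epsilon> / 16)"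
    and d: "\<And>s. s \<in> \<psi> ` E \<Longrightarrow> metr (As r) (\<sigma> s) (\<tau> s) < \<epsilon> / 2" and e: "e \<in> E"
  interpret Metric_space "carr (As r)" "metr (As r)" by (rule struct_of_metric[OF As[OF r]])
  have eF: "e \<in> F" "\<psi> e \<in> F" using F e by auto
  have near: "metr (As r) (\<rho> e) (\<rho> (\<psi> e)) \<le> \<epsilon> / 8 + \<epsilon> / 16" and car: "\<rho> e \<in> carr (As r)" "\<rho> (\<psi> e) \<in> carr (As r)"
    if "\<rho> \<in> CMS \<L> A (As r) F R (\<epsilon> / 16)" for \<rho>
  proof -
    have "metr (As r) (\<rho> e) (\<rho> (\<psi> e)) \<le> metr A e (\<psi> e) + \<epsilon> / 16"
      using that eF by (auto simp: CMS_def almost_contractive_def)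
    then show "metr (As r) (\<rho> e) (\<rho> (\<psi> e)) \<le> \<epsilon> / 8 + \<epsilon> / 16" using \<psi>[OF e] by simp
    show "\<rho> e \<in> carr (As r)" "\<rho> (\<psi> e) \<in> carr (As r)" using that eF by (auto simp: CMS_def MS_def)
  qed
  have "metr (As r) (\<sigma> e) (\<tau> e) \<le> metr (As r) (\<sigma> e) (\<sigma> (\<psi> e)) + metr (As r) (\<sigma> (\<psi> e)) (\<tau> e)"
    by (intro triangle car st)
  also have "metr (As r) (\<sigma> (\<psi> e)) (\<tau> e)
      \<le> metr (As r) (\<sigma> (\<psi> e)) (\<tau> (\<psi> e)) + metr (As r) (\<tau> (\<psi> e)) (\<tau> e)"
    by (intro triangle car st)
  finally show "metr (As r) (\<sigma> e) (\<tau> e) < \<epsilon>"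
    using near[OF st(1)] near[OF st(2)] d[of "\<psi> e"] e \<epsilon> by (simp add: commute)
qed (use assms in auto)

text \<open>Fixing domains that contain \<open>xs\<close> fixes one modulus; every \<open>ys\<close>
  in the same domains and close enough to \<open>xs\<close> is governed by it. The form with a
  filter allows finitely many symbols and tuples to be treated with a common
  \<open>\<kappa>\<close>.\<close>

lemma eventually_value_dist_le:
  assumes L: "language \<L>" and A: "struct_of \<L> A" and s: "s \<in> symbols \<L>"
    and xs: "length xs = arity \<L> s" "set xs \<subseteq> carr A" and \<epsilon>: "0 < \<epsilon>"
  shows "\<forall>\<^sub>F \<kappa> in at_right (0::real). \<forall>ys. length ys = length xs \<longrightarrow>
    (\<forall>i<length xs. metr A (xs ! i) (ys ! i) < \<kappa> \<and>
       (\<forall>D\<in>dsyms \<L>. xs ! i \<in> dint A D \<longrightarrow> ys ! i \<in> dint A D)) \<longrightarrow> value_dist A s xs ys \<le> \<epsilon>"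
proof -
  obtain Ds where Ds: "Ds \<in> dom_tuples \<L> (length xs)" "\<And>i. i < length xs \<Longrightarrow> xs ! i \<in> dint A (Ds ! i)"
    using obtain_domain_tuple[OF A xs(2)] by blast
  let ?n = "length xs"
  define \<epsilon>0 where "\<epsilon>0 = min 1 (\<epsilon> / (?n + 1))"
  have "?n * \<epsilon>0 \<le> ?n * (\<epsilon> / (?n + 1))" by (intro mult_left_mono) (auto simp: \<epsilon>0_def)
  also have "\<dots> \<le> \<epsilon>" using \<epsilon> by (simp add: field_simps)
  finally have \<epsilon>0: "0 < \<epsilon>0" "\<epsilon>0 \<le> 1" "?n * \<epsilon>0 \<le> \<epsilon>" using \<epsilon> by (auto simp: \<epsilon>0_def)
  \<comment> \<open>In arity 0 there are no coordinates to move, and the default 1 replaces a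
    modulus that need not be positive.\<close>
  define \<kappa>0 where "\<kappa>0 = (if ?n = 0 then 1 else modulus \<L> s Ds \<epsilon>0)"
  have "\<kappa>0 > 0" using modulus_bounds(1)[OF L s _ _ \<epsilon>0(1,2)] Ds xs by (auto simp: \<kappa>0_def)
  then have "\<forall>\<^sub>F \<kappa> in at_right 0. \<kappa> < \<kappa>0" by (rule eventually_at_right_below)
  then show ?thesis
  proof eventually_elim
    case (elim \<kappa>)
    show ?case
    proof (intro allI impI)
      fix ys assume ys: "length ys = ?n" "\<forall>i<?n. metr A (xs ! i) (ys ! i) < \<kappa> \<and>
         (\<forall>D\<in>dsyms \<L>. xs ! i \<in> dint A D \<longrightarrow> ys ! i \<in> dint A D)"
      have "value_dist A s xs ys \<le> ?n * \<epsilon>0"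
      proof (rule value_dist_le[OF A s xs(1)[symmetric] refl ys(1) Ds _ \<epsilon>0(1,2)])
        fix i assume i: "i < ?n"
        then have "Ds ! i \<in> dsyms \<L>" using Ds(1) by (auto simp: dom_tuples_def)
        then show "ys ! i \<in> dint A (Ds ! i)" using ys(2) Ds(2) i by blast
        have "?n \<noteq> 0" using i by linarith
        then have "\<kappa>0 = modulus \<L> s Ds \<epsilon>0" by (simp only: \<kappa>0_def if_False)
        then show "metr A (xs ! i) (ys ! i) < modulus \<L> s Ds \<epsilon>0"
          using ys(2) i elim by force
      qed
      then show "value_dist A s xs ys \<le> \<epsilon>" using \<epsilon>0(3) by simp
    qed
  qed
qed

text \<open>The errors add up as follows. For a term, \<open>\<psi> y\<close> and the value at the
  displaced arguments are within \<open>2 * \<delta>\<close> in \<open>A\<close>; contractivity of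
  \<open>\<sigma>\<close> makes this \<open>3 * \<delta>\<close> in \<open>B\<close>, and the
  microstate condition at the displaced arguments adds a last \<open>\<delta>\<close>. That
  condition can be used because \<open>val\<close> puts the value into the domain \<open>F\<close>
  of \<open>\<sigma>\<close>. State symbols cost \<open>2 * \<delta>\<close> and contractivity
  \<open>3 * \<delta>\<close>.\<close>

lemma CMS_compose:
  assumes A: "struct_of \<L> A" and B: "struct_of \<L> B" and R: "R \<subseteq> symbols \<L>"
    and \<sigma>: "\<sigma> \<in> CMS \<L> A B F R \<delta>" and F': "F' \<subseteq> carr A" and \<psi>F: "\<psi> ` F' \<subseteq> F" and \<delta>: "0 < \<delta>"
    and \<psi>: "\<And>a. a \<in> F' \<Longrightarrow> metr A a (\<psi> a) < \<delta>" "\<And>a. a \<in> F' \<Longrightarrow> \<psi> a \<in> carr A"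
      "\<And>a D. a \<in> F' \<Longrightarrow> D \<in> dsyms \<L> \<Longrightarrow> a \<in> dint A D \<Longrightarrow> \<psi> a \<in> dint A D"
    and vd: "\<And>s xs. s \<in> R \<Longrightarrow> set xs \<subseteq> F' \<Longrightarrow> length xs = arity \<L> s \<Longrightarrow>
      value_dist A s xs (map \<psi> xs) \<le> \<delta>"
    and val: "\<And>n t xs. TermSym n t \<in> R \<Longrightarrow> set xs \<subseteq> F' \<Longrightarrow> length xs = n \<Longrightarrow>
      eval A (map \<psi> xs) t \<in> F"
  shows "restrict (\<sigma> \<circ> \<psi>) F' \<in> CMS \<L> A B F' R (4 * \<delta>)"
proof -
  interpret A: Metric_space "carr A" "metr A" by (rule struct_of_metric[OF A])
  interpret B: Metric_space "carr B" "metr B" by (rule struct_of_metric[OF B])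
  have ms: "microstate \<L> A B F R \<delta> \<sigma>" "domain_preserving \<L> A B F \<sigma>" "\<sigma> \<in> F \<rightarrow>\<^sub>E carr B"
    "almost_contractive A B F \<delta> \<sigma>"
    using \<sigma> by (auto simp: CMS_def MS_def)
  have \<sigma>car: "\<sigma> x \<in> carr B" if "x \<in> F" for x using ms(3) that by auto
  have map: "map (restrict (\<sigma> \<circ> \<psi>) F') xs = map \<sigma> (map \<psi> xs)" if "set xs \<subseteq> F'" for xs
    using that by auto
  have contr: "metr B (\<sigma> a) (\<sigma> b) \<le> metr A a b + \<delta>" if "a \<in> F" "b \<in> F" for a b
    using ms(4) that by (auto simp: almost_contractive_def)
  have "microstate \<L> A B F' R (4 * \<delta>) (restrict (\<sigma> \<circ> \<psi>) F')"
    unfolding microstate_def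
  proof (intro conjI allI impI)
    fix n t xs y
    assume *: "TermSym n t \<in> R" "length xs = n" "set xs \<subseteq> F'" "y \<in> F'" "y = eval A xs t"
    let ?b = "eval A (map \<psi> xs) t"
    have t: "t \<in> terms \<L> n" using R *(1) by (auto simp: symbols_def)
    have b: "?b \<in> F" using val * by blast
    have bA: "?b \<in> carr A" using t *(2,3) \<psi>(2) by (auto intro!: eval_in_carr[OF A] simp: subset_iff)
    have \<psi>y: "\<psi> y \<in> F" using \<psi>F *(4) by auto
    have \<psi>xs: "set (map \<psi> xs) \<subseteq> F" using \<psi>F *(3) by auto
    have "metr A y ?b \<le> \<delta>" using vd[OF *(1,3)] * by simp
    \<comment> \<open>Both \<open>\<psi> y\<close> and \<open>?b\<close> are near \<open>y\<close>,
      the first by the choice of \<open>\<psi>\<close>, the second by continuity of the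
      term.\<close>
    moreover have "metr A (\<psi> y) ?b \<le> metr A (\<psi> y) y + metr A y ?b"
      using *(4) F' bA \<psi>(2) by (intro A.triangle) auto
    ultimately have 1: "metr A (\<psi> y) ?b \<le> 2 * \<delta>" using \<psi>(1)[OF *(4)] by (simp add: A.commute)
    have "metr B (\<sigma> (\<psi> y)) (eval B (map \<sigma> (map \<psi> xs)) t)
        \<le> metr B (\<sigma> (\<psi> y)) (\<sigma> ?b) + metr B (\<sigma> ?b) (eval B (map \<sigma> (map \<psi> xs)) t)"
      using \<psi>xs \<sigma>car t *(2) by (intro B.triangle \<sigma>car \<psi>y b eval_in_carr[OF B]) auto
    also have "metr B (\<sigma> ?b) (eval B (map \<sigma> (map \<psi> xs)) t) \<le> \<delta>"
      using ms(1) *(1,2) \<psi>xs b unfolding microstate_def by (metis length_map)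
    finally have "metr B (\<sigma> (\<psi> y)) (eval B (map \<sigma> (map \<psi> xs)) t) \<le> 4 * \<delta>"
      using contr[OF \<psi>y b] 1 by simp
    then show "metr B (restrict (\<sigma> \<circ> \<psi>) F' y) (eval B (map (restrict (\<sigma> \<circ> \<psi>) F') xs) t) \<le> 4 * \<delta>"
      using *(4) by (simp only: map[OF *(3)]) simp
  next
    fix g xs
    assume *: "StateSym g \<in> R" "length xs = garity \<L> g" "set xs \<subseteq> F'"
    have \<psi>xs: "set (map \<psi> xs) \<subseteq> F" using \<psi>F *(3) by auto
    have "\<bar>gint A g (map \<psi> xs) - gint B g (map \<sigma> (map \<psi> xs))\<bar> \<le> \<delta>"
      using ms(1) *(1,2) \<psi>xs unfolding microstate_def by (metis length_map)
    moreover have "\<bar>gint A g xs - gint A g (map \<psi> xs)\<bar> \<le> \<delta>" using vd[OF *(1,3)] * by simp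
    ultimately show "\<bar>gint A g xs - gint B g (map (restrict (\<sigma> \<circ> \<psi>) F') xs)\<bar> \<le> 4 * \<delta>"
      using \<delta> by (simp only: map[OF *(3)])
  qed
  moreover have "domain_preserving \<L> A B F' (restrict (\<sigma> \<circ> \<psi>) F')"
    using ms(2) \<psi>(3) \<psi>F by (auto simp: domain_preserving_def)
  moreover have "almost_contractive A B F' (4 * \<delta>) (restrict (\<sigma> \<circ> \<psi>) F')"
    unfolding almost_contractive_def
  proof (intro ballI)
    fix a b assume ab: "a \<in> F'" "b \<in> F'"
    have "metr B (\<sigma> (\<psi> a)) (\<sigma> (\<psi> b)) \<le> metr A (\<psi> a) (\<psi> b) + \<delta>" using ab \<psi>F by (intro contr) auto
    moreover have "metr A (\<psi> a) (\<psi> b) \<le> metr A (\<psi> a) a + metr A a (\<psi> b)"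
      using ab F' \<psi>(2) by (intro A.triangle) auto
    moreover have "metr A a (\<psi> b) \<le> metr A a b + metr A b (\<psi> b)"
      using ab F' \<psi>(2) by (intro A.triangle) auto
    ultimately have "metr B (\<sigma> (\<psi> a)) (\<sigma> (\<psi> b)) \<le> metr A a b + 4 * \<delta>"
      using \<psi>(1)[OF ab(1)] \<psi>(1)[OF ab(2)] \<delta> A.commute[of a "\<psi> a"] by linarith
    then show "metr B (restrict (\<sigma> \<circ> \<psi>) F' a) (restrict (\<sigma> \<circ> \<psi>) F' b) \<le> metr A a b + 4 * \<delta>"
      using ab by simp
  qed
  moreover have "restrict (\<sigma> \<circ> \<psi>) F' \<in> F' \<rightarrow>\<^sub>E carr B"
    using \<sigma>car \<psi>F by auto
  ultimately show ?thesis by (simp add: CMS_def MS_def)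
qed

text \<open>On the left the infimum runs only over sets \<open>F\<close> inside the generated
  substructure. A set \<open>F'\<close> in the carrier is replaced by its image under an
  approximation \<open>\<psi>\<close> into the substructure, enlarged by the term values at
  displaced arguments; composition with \<open>\<psi>\<close> then turns microstates on the new set
  into microstates on \<open>F'\<close>.\<close>

lemma entropy_at_CMS_dense_le:
  assumes L: "language \<L>" and A: "struct_of \<L> A" and As: "\<And>r. r \<ge> 1 \<Longrightarrow> struct_of \<L> (As r)"
    and N: "\<And>r. r \<ge> 1 \<Longrightarrow> N r > 0" and G: "G \<subseteq> carr A" "top_generating \<L> A G"
    and E: "finite E" "E \<subseteq> generated \<L> A G" and \<epsilon>: "0 < \<epsilon>"
  shows "entropy_at CMS \<L> A As N E (generated \<L> A G) \<epsilon> \<le> entropy_at CMS \<L> A As N E (carr A) \<epsilon>"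
proof (rule entropy_at_le[OF N])
  interpret A: Metric_space "carr A" "metr A" by (rule struct_of_metric[OF A])
  fix \<delta>' :: real and R' F'
  assume p: "0 < \<delta>'" "finite R'" "R' \<subseteq> symbols \<L>" "E \<subseteq> F'" "finite F'" "F' \<subseteq> carr A"
  define \<delta> where "\<delta> = \<delta>' / 4"
  have \<delta>: "\<delta> > 0" "\<delta>' = 4 * \<delta>" using p by (auto simp: \<delta>_def)
  \<comment> \<open>All symbols of \<open>R'\<close> together with all argument tuples from
    \<open>F'\<close>. There are finitely many, so one \<open>\<kappa>\<close> works for all of
    them.\<close>
  define P where "P = (SIGMA s:R'. {xs. set xs \<subseteq> F' \<and> length xs = arity \<L> s})"
  have finP: "finite P" unfolding P_def using p by (intro finite_SigmaI finite_lists_length_eq) auto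
  have "\<forall>\<^sub>F \<kappa> in at_right (0::real). \<forall>p\<in>P. \<forall>ys. length ys = length (snd p) \<longrightarrow>
    (\<forall>i<length (snd p). metr A (snd p ! i) (ys ! i) < \<kappa> \<and>
       (\<forall>D\<in>dsyms \<L>. snd p ! i \<in> dint A D \<longrightarrow> ys ! i \<in> dint A D)) \<longrightarrow> value_dist A (fst p) (snd p) ys \<le> \<delta>"
  proof (rule eventually_ball_finite[OF finP], rule ballI)
    fix p assume "p \<in> P"
    then show "\<forall>\<^sub>F \<kappa> in at_right (0::real). \<forall>ys. length ys = length (snd p) \<longrightarrow>
    (\<forall>i<length (snd p). metr A (snd p ! i) (ys ! i) < \<kappa> \<and>
       (\<forall>D\<in>dsyms \<L>. snd p ! i \<in> dint A D \<longrightarrow> ys ! i \<in> dint A D)) \<longrightarrow> value_dist A (fst p) (snd p) ys \<le> \<delta>"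
      using p \<delta> by (intro eventually_value_dist_le[OF L A]) (auto simp: P_def)
  qed
  moreover have "\<forall>\<^sub>F \<kappa> in at_right (0::real). \<kappa> < \<delta>"
    using \<delta>(1) by (rule eventually_at_right_below)
  moreover have "\<forall>\<^sub>F \<kappa> in at_right (0::real). 0 < \<kappa>" by (rule eventually_at_right_less)
  ultimately have "\<forall>\<^sub>F \<kappa> in at_right (0::real). 0 < \<kappa> \<and> \<kappa> < \<delta> \<and> (\<forall>p\<in>P. \<forall>ys. length ys = length (snd p) \<longrightarrow>
    (\<forall>i<length (snd p). metr A (snd p ! i) (ys ! i) < \<kappa> \<and>
       (\<forall>D\<in>dsyms \<L>. snd p ! i \<in> dint A D \<longrightarrow> ys ! i \<in> dint A D)) \<longrightarrow> value_dist A (fst p) (snd p) ys \<le> \<delta>)"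
    by eventually_elim blast
  then obtain \<kappa> where \<kappa>: "0 < \<kappa>" "\<kappa> < \<delta>" and vd: "\<forall>p\<in>P. \<forall>ys. length ys = length (snd p) \<longrightarrow>
    (\<forall>i<length (snd p). metr A (snd p ! i) (ys ! i) < \<kappa> \<and>
       (\<forall>D\<in>dsyms \<L>. snd p ! i \<in> dint A D \<longrightarrow> ys ! i \<in> dint A D)) \<longrightarrow> value_dist A (fst p) (snd p) ys \<le> \<delta>"
    using eventually_happens'[OF trivial_limit_at_right_real] by blast
  have "\<forall>x\<in>carr A. \<exists>y\<in>generated \<L> A G. metr A x y < \<kappa> \<and> (\<forall>D\<in>dsyms \<L>. x \<in> dint A D \<longrightarrow> y \<in> dint A D)"
    using G(2) \<kappa>(1) by (auto simp: top_generating_def)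
  then obtain \<phi> where \<phi>: "\<And>x. x \<in> carr A \<Longrightarrow> \<phi> x \<in> generated \<L> A G \<and> metr A x (\<phi> x) < \<kappa> \<and>
      (\<forall>D\<in>dsyms \<L>. x \<in> dint A D \<longrightarrow> \<phi> x \<in> dint A D)" by metis
  \<comment> \<open>Fixing \<open>E\<close> pointwise means that composition with
    \<open>\<psi>\<close> leaves the maps unchanged on \<open>E\<close>, so neither \<open>E\<close>
    nor the scale \<open>\<epsilon>\<close> is altered.\<close>
  define \<psi> where "\<psi> x = (if x \<in> E then x else \<phi> x)" for x
  have \<psi>: "\<psi> x \<in> generated \<L> A G" "metr A x (\<psi> x) < \<kappa>"
    "\<And>D. D \<in> dsyms \<L> \<Longrightarrow> x \<in> dint A D \<Longrightarrow> \<psi> x \<in> dint A D" if "x \<in> F'" for x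
  proof -
    have x: "x \<in> carr A" using that p(6) by blast
    have *: "\<psi> x \<in> generated \<L> A G \<and> metr A x (\<psi> x) < \<kappa> \<and> (\<forall>D\<in>dsyms \<L>. x \<in> dint A D \<longrightarrow> \<psi> x \<in> dint A D)"
    proof (cases "x \<in> E")
      case True
      then show ?thesis using E(2) \<kappa>(1) A.mdist_zero[OF x] by (auto simp: \<psi>_def)
    next
      case False
      then show ?thesis using \<phi>[OF x] by (simp add: \<psi>_def)
    qed
    show "\<psi> x \<in> generated \<L> A G" "metr A x (\<psi> x) < \<kappa>" using * by simp_all
    show "\<psi> x \<in> dint A D" if "D \<in> dsyms \<L>" "x \<in> dint A D" for D using * that by simp
  qed
  \<comment> \<open>The term values at displaced arguments, which usually differ from the displaced
    values and must be in the domain of the microstate. State symbols take real values and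
    contribute no points.\<close>
  define V where "V = (\<Union>(s, xs)\<in>P. case s of TermSym n t \<Rightarrow> {eval A (map \<psi> xs) t} | StateSym g \<Rightarrow> {})"
  have "finite V" using finP unfolding V_def by (intro finite_UN_I) (auto split: symb.split)
  have VG: "V \<subseteq> generated \<L> A G"
  proof
    fix v assume "v \<in> V"
    then obtain n t xs where v: "TermSym n t \<in> R'" "set xs \<subseteq> F'" "length xs = n" "v = eval A (map \<psi> xs) t"
    proof -
      from \<open>v \<in> V\<close> obtain s xs where s: "s \<in> R'" "set xs \<subseteq> F'" "length xs = arity \<L> s"
        "v \<in> (case s of TermSym n t \<Rightarrow> {eval A (map \<psi> xs) t} | StateSym g \<Rightarrow> {})"
        unfolding V_def P_def by blast
      then show thesis using that by (cases s) auto
    qed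
    then have "t \<in> terms \<L> n" using p(3) by (auto simp: symbols_def)
    then show "v \<in> generated \<L> A G"
      using v \<psi>(1) by (auto intro!: eval_in_generated simp: subset_iff)
  qed
  let ?F = "\<psi> ` F' \<union> V"
  have EF: "E \<subseteq> ?F"
  proof
    fix e assume "e \<in> E"
    then have "e = \<psi> e" "e \<in> F'" using p by (auto simp: \<psi>_def)
    then show "e \<in> ?F" by blast
  qed
  have "sep_number (As r) E \<epsilon> (CMS \<L> A (As r) ?F R' \<delta>) \<le> sep_number (As r) E \<epsilon> (CMS \<L> A (As r) F' R' \<delta>')"
    if r: "r \<ge> 1" for r
  proof (rule sep_number_le[where \<Psi> = "\<lambda>\<sigma>. restrict (\<sigma> \<circ> \<psi>) F'"])
    fix \<sigma> assume \<sigma>: "\<sigma> \<in> CMS \<L> A (As r) ?F R' \<delta>"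
    show mem: "restrict (\<sigma> \<circ> \<psi>) F' \<in> CMS \<L> A (As r) F' R' \<delta>'"
      unfolding \<delta>(2)
    proof (rule CMS_compose[OF A As[OF r] p(3) \<sigma> p(6) _ \<delta>(1)])
      fix s xs assume s: "s \<in> R'" "set xs \<subseteq> F'" "length xs = arity \<L> s"
      then have sP: "(s, xs) \<in> P" by (auto simp: P_def)
      have "\<forall>i<length xs. metr A (xs ! i) (map \<psi> xs ! i) < \<kappa> \<and>
          (\<forall>D\<in>dsyms \<L>. xs ! i \<in> dint A D \<longrightarrow> map \<psi> xs ! i \<in> dint A D)"
        using \<psi> s(2) nth_mem by (simp add: subset_iff)
      then show "value_dist A s xs (map \<psi> xs) \<le> \<delta>"
        using vd[rule_format, OF sP, of "map \<psi> xs"] by simp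
    next
      fix n t xs assume "TermSym n t \<in> R'" "set xs \<subseteq> F'" "length xs = n"
      then have "(TermSym n t, xs) \<in> P" by (auto simp: P_def)
      then have "eval A (map \<psi> xs) t \<in> V" unfolding V_def by (rule UN_I) simp
      then show "eval A (map \<psi> xs) t \<in> ?F" by blast
    next
      fix a assume a: "a \<in> F'"
      show "metr A a (\<psi> a) < \<delta>" using \<psi>(2)[OF a] \<kappa> by simp
      show "\<psi> a \<in> carr A" using \<psi>(1)[OF a] generated_subset_carr[OF A G(1)] by blast
    qed (use \<psi>(3) in auto)
    have "restrict (\<sigma> \<circ> \<psi>) F' \<in> F' \<rightarrow> carr (As r)" using mem by (auto simp: CMS_def MS_def)
    then show "map_dist (As r) E (restrict (\<sigma> \<circ> \<psi>) F') (restrict (\<sigma> \<circ> \<psi>) F') < \<epsilon>"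
      by (rule map_dist_refl_less[OF As[OF r] _ p(4) E(1) \<epsilon>])
    fix \<tau>
    assume "map_dist (As r) E (restrict (\<sigma> \<circ> \<psi>) F') (restrict (\<tau> \<circ> \<psi>) F') < \<epsilon>"
    then show "map_dist (As r) E \<sigma> \<tau> < \<epsilon>"
      using E(1) \<epsilon> p(4) by (auto simp: map_dist_less_iff \<psi>_def subset_iff)
  qed
  then show "\<exists>\<delta>>0. \<exists>R F. finite R \<and> R \<subseteq> symbols \<L> \<and> E \<subseteq> F \<and> finite F \<and> F \<subseteq> generated \<L> A G \<and>
        (\<forall>r\<ge>1. sep_number (As r) E \<epsilon> (CMS \<L> A (As r) F R \<delta>)
              \<le> sep_number (As r) E \<epsilon> (CMS \<L> A (As r) F' R' \<delta>'))"
    using p \<delta>(1) EF VG \<psi>(1) \<open>finite V\<close>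
    by (intro exI[of _ \<delta>] conjI exI[of _ R'] exI[of _ ?F]) auto
qed

text \<open>For \<open>E\<close> in the carrier, first move \<open>E\<close> into the generated
  substructure by contractivity, then replace it by finitely many generators at a smaller scale.
  Conversely, for \<open>E\<close> inside \<open>G\<close> only the range of the sets
  \<open>F\<close> changes, which is settled by the density argument.\<close>

lemma entropy_CMS_top_generating:
  assumes L: "language \<L>" and A: "struct_of \<L> A" and As: "\<And>r. r \<ge> 1 \<Longrightarrow> struct_of \<L> (As r)"
    and N: "\<And>r. r \<ge> 1 \<Longrightarrow> N r > 0" and G: "G \<subseteq> carr A" "top_generating \<L> A G"
  shows "entropy CMS \<L> A As N (carr A) = entropy CMS \<L> A As N G"
proof (rule antisym)
  let ?h = "entropy_at CMS \<L> A As N"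
  have GA: "generated \<L> A G \<subseteq> carr A" by (rule generated_subset_carr[OF A G(1)])
  show "entropy CMS \<L> A As N (carr A) \<le> entropy CMS \<L> A As N G"
    unfolding entropy_def[of CMS \<L> A As N "carr A"] generated_carr[OF A]
  proof (intro SUP_least)
    fix E \<epsilon> assume "E \<in> {E. finite E \<and> E \<subseteq> carr A}" "\<epsilon> \<in> {0::real<..}"
    then have E: "finite E" "E \<subseteq> carr A" and \<epsilon>: "\<epsilon> > 0" by auto
    have "\<forall>x\<in>carr A. \<exists>y\<in>generated \<L> A G. metr A x y < \<epsilon> / 8"
      using G(2) \<epsilon> by (meson divide_pos_pos top_generating_def zero_less_numeral)
    then obtain \<psi> where \<psi>: "\<And>x. x \<in> carr A \<Longrightarrow> \<psi> x \<in> generated \<L> A G \<and> metr A x (\<psi> x) < \<epsilon> / 8"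
      by metis
    have \<psi>gen: "\<psi> ` E \<subseteq> generated \<L> A G" using E(2) \<psi> by blast
    have \<psi>E: "finite (\<psi> ` E)" "\<psi> ` E \<subseteq> carr A" "\<psi> ` E \<subseteq> generated \<L> A G" "0 < \<epsilon> / 2"
      using E(1) \<psi>gen GA \<epsilon> by simp_all
    \<comment> \<open>The same step passes to generators and shrinks the range of \<open>F\<close>
      from the carrier to the substructure, which can only raise the infimum.\<close>
    obtain E' \<epsilon>' where E': "finite E'" "E' \<subseteq> G" "0 < \<epsilon>'"
      and "?h (\<psi> ` E) (carr A) (\<epsilon> / 2) \<le> ?h E' (generated \<L> A G) \<epsilon>'"
      by (rule entropy_at_generators_le[OF disjI2[OF refl] L A As N \<psi>E(1-3) GA G(1) \<psi>E(4)])
    note E'_le = this(4)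
    have "?h E (carr A) \<epsilon> \<le> ?h (\<psi> ` E) (carr A) (\<epsilon> / 2)"
      using E \<psi> \<psi>E(2) \<epsilon> by (intro entropy_at_CMS_perturb[OF A As N]) auto
    also note E'_le
    also have "?h E' (generated \<L> A G) \<epsilon>' \<le> entropy CMS \<L> A As N G"
      unfolding entropy_def using E' by (intro SUP_upper2[of E'] SUP_upper2[of \<epsilon>']) auto
    finally show "?h E (carr A) \<epsilon> \<le> entropy CMS \<L> A As N G" .
  qed
  show "entropy CMS \<L> A As N G \<le> entropy CMS \<L> A As N (carr A)"
    unfolding entropy_def[of CMS \<L> A As N G]
  proof (intro SUP_least)
    fix E \<epsilon> assume "E \<in> {E. finite E \<and> E \<subseteq> G}" "\<epsilon> \<in> {0::real<..}"
    then have E: "finite E" "E \<subseteq> G" and \<epsilon>: "\<epsilon> > 0" by auto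
    have "?h E (generated \<L> A G) \<epsilon> \<le> ?h E (carr A) \<epsilon>"
      using E subset_generated[of G \<L> A] by (intro entropy_at_CMS_dense_le[OF L A As N G _ _ \<epsilon>]) auto
    also have "\<dots> \<le> entropy CMS \<L> A As N (carr A)"
      unfolding entropy_def generated_carr[OF A]
      using E G(1) \<epsilon> by (intro SUP_upper2[of E] SUP_upper2[of \<epsilon>]) auto
    finally show "?h E (generated \<L> A G) \<epsilon> \<le> entropy CMS \<L> A As N (carr A)" .
  qed
qed

section \<open>The metric as a state symbol\<close>

text \<open>The microstate condition for \<open>g\<close> at the pair \<open>[a, b]\<close> compares
  the two distances up to \<open>\<delta>\<close>, and one half of this is contractivity.\<close>

lemma MS_metric_symbol_subset_CMS:
  assumes g: "StateSym g \<in> R" "metric_symbol_in \<L> g A" "metric_symbol_in \<L> g B" and F: "F \<subseteq> carr A"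
  shows "MS \<L> A B F R \<delta> \<subseteq> CMS \<L> A B F R \<delta>"
proof
  fix \<sigma> assume \<sigma>: "\<sigma> \<in> MS \<L> A B F R \<delta>"
  have "metr B (\<sigma> a) (\<sigma> b) \<le> metr A a b + \<delta>" if "a \<in> F" "b \<in> F" for a b
  proof -
    have "microstate \<L> A B F R \<delta> \<sigma>" using \<sigma> by (simp add: MS_def)
    moreover have "length [a, b] = garity \<L> g" using g(2) by (simp add: metric_symbol_in_def)
    moreover have "set [a, b] \<subseteq> F" using that by simp
    ultimately have "\<bar>gint A g [a, b] - gint B g (map \<sigma> [a, b])\<bar> \<le> \<delta>"
      using g(1) unfolding microstate_def by blast
    moreover have "\<sigma> a \<in> carr B" "\<sigma> b \<in> carr B" using \<sigma> that by (auto simp: MS_def)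
    ultimately show ?thesis
      using g F that by (auto simp: metric_symbol_in_def subset_iff)
  qed
  then show "\<sigma> \<in> CMS \<L> A B F R \<delta>" using \<sigma> by (auto simp: CMS_def almost_contractive_def)
qed

lemma sep_number_mono: "Y \<subseteq> Y' \<Longrightarrow> sep_number B E \<epsilon> Y \<le> sep_number B E \<epsilon> Y'"
  unfolding sep_number_def by (intro SUP_subset_mono) auto

text \<open>The infimum is over all finite \<open>R\<close>, so \<open>g\<close> may be added to
  \<open>R\<close>, after which every microstate is contractive. The other inequality comes from the
  inclusion of \<open>CMS\<close> in \<open>MS\<close>.\<close>

lemma entropy_MS_eq_CMS:
  assumes A: "struct_of \<L> A" and N: "\<And>r. r \<ge> 1 \<Longrightarrow> N r > 0" and G: "G \<subseteq> carr A"
    and g: "g \<in> gsyms \<L>" "metric_symbol_in \<L> g A" "\<And>r. r \<ge> 1 \<Longrightarrow> metric_symbol_in \<L> g (As r)"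
  shows "entropy MS \<L> A As N G = entropy CMS \<L> A As N G"
proof -
  have "entropy_at MS \<L> A As N E (generated \<L> A G) \<epsilon> = entropy_at CMS \<L> A As N E (generated \<L> A G) \<epsilon>" for E \<epsilon>
  proof (rule antisym)
    show "entropy_at MS \<L> A As N E (generated \<L> A G) \<epsilon> \<le> entropy_at CMS \<L> A As N E (generated \<L> A G) \<epsilon>"
    proof (rule entropy_at_le[OF N])
      fix \<delta>' :: real and R' F'
      assume p: "0 < \<delta>'" "finite R'" "R' \<subseteq> symbols \<L>" "E \<subseteq> F'" "finite F'" "F' \<subseteq> generated \<L> A G"
      let ?R = "insert (StateSym g) R'"
      have F: "F' \<subseteq> carr A" using p(6) generated_subset_carr[OF A G] by blast
      have "MS \<L> A (As r) F' ?R \<delta>' \<subseteq> CMS \<L> A (As r) F' R' \<delta>'" if r: "r \<ge> 1" for r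
      proof -
        have "MS \<L> A (As r) F' ?R \<delta>' \<subseteq> CMS \<L> A (As r) F' ?R \<delta>'"
          using g r F by (intro MS_metric_symbol_subset_CMS) auto
        also have "\<dots> \<subseteq> CMS \<L> A (As r) F' R' \<delta>'"
          by (auto simp: CMS_def MS_def microstate_def)
        finally show ?thesis .
      qed
      then show "\<exists>\<delta>>0. \<exists>R F. finite R \<and> R \<subseteq> symbols \<L> \<and> E \<subseteq> F \<and> finite F \<and> F \<subseteq> generated \<L> A G \<and>
        (\<forall>r\<ge>1. sep_number (As r) E \<epsilon> (MS \<L> A (As r) F R \<delta>)
              \<le> sep_number (As r) E \<epsilon> (CMS \<L> A (As r) F' R' \<delta>'))"
        using p g(1)
        by (intro exI[of _ \<delta>'] conjI exI[of _ ?R] exI[of _ F']) (auto simp: symbols_def intro: sep_number_mono)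
    qed
    show "entropy_at CMS \<L> A As N E (generated \<L> A G) \<epsilon> \<le> entropy_at MS \<L> A As N E (generated \<L> A G) \<epsilon>"
    proof (rule entropy_at_le[OF N])
      fix \<delta>' :: real and R' F'
      assume p: "0 < \<delta>'" "finite R'" "R' \<subseteq> symbols \<L>" "E \<subseteq> F'" "finite F'" "F' \<subseteq> generated \<L> A G"
      then show "\<exists>\<delta>>0. \<exists>R F. finite R \<and> R \<subseteq> symbols \<L> \<and> E \<subseteq> F \<and> finite F \<and> F \<subseteq> generated \<L> A G \<and>
        (\<forall>r\<ge>1. sep_number (As r) E \<epsilon> (CMS \<L> A (As r) F R \<delta>)
              \<le> sep_number (As r) E \<epsilon> (MS \<L> A (As r) F' R' \<delta>'))"
        by (intro exI[of _ \<delta>'] conjI exI[of _ R'] exI[of _ F'])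
           (auto intro!: sep_number_mono simp: CMS_def)
    qed
  qed
  then show ?thesis by (simp add: entropy_def)
qed

section \<open>Change of scale and the entropy dimension\<close>

text \<open>With a scale u at most \<epsilon>, the quotient f(\<epsilon>)/L(\<epsilon>) is at most
  k(u)/L(u) times L(u)/L(\<epsilon>), and the last factor tends to 1.\<close>

lemma Limsup_comparison:
  fixes f k :: "real \<Rightarrow> ereal" and L \<omega> :: "real \<Rightarrow> real"
  assumes L: "\<And>\<epsilon>. \<epsilon> > 0 \<Longrightarrow> L \<epsilon> > 0"
    and \<omega>: "\<And>\<epsilon>. 0 < \<epsilon> \<Longrightarrow> \<epsilon> \<le> 1 \<Longrightarrow> 0 < \<omega> \<epsilon>" "((\<lambda>\<epsilon>. L (\<omega> \<epsilon>) / L \<epsilon>) \<longlongrightarrow> 1) (at_right 0)"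
    and f: "\<And>\<epsilon>. 0 < \<epsilon> \<Longrightarrow> \<epsilon> \<le> 1 \<Longrightarrow> f \<epsilon> \<le> k (\<omega> \<epsilon>)"
    and k: "\<And>\<epsilon> \<epsilon>'. 0 < \<epsilon>' \<Longrightarrow> \<epsilon>' \<le> \<epsilon> \<Longrightarrow> k \<epsilon> \<le> k \<epsilon>'"
  shows "Limsup (at_right 0) (\<lambda>\<epsilon>. f \<epsilon> / ereal (L \<epsilon>)) \<le> Limsup (at_right 0) (\<lambda>\<epsilon>. k \<epsilon> / ereal (L \<epsilon>))"
    (is "?l \<le> ?r")
proof (rule dense_ge)
  fix z assume z: "?r < z"
  \<comment> \<open>\<open>\<omega>\<close> need not tend to 0: a modulus may be constant, for instance on a discrete domain.\<close>
  define u where "u \<epsilon> = min \<epsilon> (\<omega> \<epsilon>)" for \<epsilon>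
  have u: "0 < u \<epsilon>" "u \<epsilon> \<le> \<epsilon>" "f \<epsilon> \<le> k (u \<epsilon>)" if "0 < \<epsilon>" "\<epsilon> \<le> 1" for \<epsilon>
    using that \<omega>(1)[OF that] f[OF that] k[of "u \<epsilon>" "\<omega> \<epsilon>"] by (auto simp: u_def)
  \<comment> \<open>Wherever the minimum is \<open>\<epsilon>\<close> itself the ratio equals 1
    exactly; elsewhere it is the ratio for \<open>\<omega>\<close>.\<close>
  have ratio: "((\<lambda>\<epsilon>. L (u \<epsilon>) / L \<epsilon>) \<longlongrightarrow> 1) (at_right 0)"
    unfolding tendsto_iff
  proof (intro allI impI)
    fix e :: real assume e: "e > 0"
    have "\<forall>\<^sub>F \<epsilon> in at_right 0. dist (L (\<omega> \<epsilon>) / L \<epsilon>) 1 < e"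
      using \<omega>(2) e by (auto simp: tendsto_iff)
    then show "\<forall>\<^sub>F \<epsilon> in at_right 0. dist (L (u \<epsilon>) / L \<epsilon>) 1 < e"
      using eventually_at_right_less[of "0::real"]
    proof eventually_elim
      case (elim \<epsilon>)
      then show ?case using e L[of \<epsilon>] by (auto simp: u_def min_def)
    qed
  qed
  show "?l \<le> z"
  proof (cases z)
    \<comment> \<open>Below \<open>b\<close> the quotient of \<open>k\<close> is less than
      \<open>m\<close>, and this may be used at \<open>u \<epsilon>\<close>, which is at most
      \<open>\<epsilon>\<close>. The sign of \<open>m\<close> does not matter, since
      \<open>m\<close> is multiplied by a factor tending to 1.\<close>
    case (real m)
    have "\<forall>\<^sub>F \<epsilon> in at_right 0. k \<epsilon> / ereal (L \<epsilon>) < z" using z by (rule Limsup_lessD)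
    then obtain b where b: "b > 0" "\<And>\<epsilon>. 0 < \<epsilon> \<Longrightarrow> \<epsilon> < b \<Longrightarrow> k \<epsilon> / ereal (L \<epsilon>) < z"
      by (auto simp: eventually_at_right_field)
    have "\<forall>\<^sub>F \<epsilon> in at_right 0. f \<epsilon> / ereal (L \<epsilon>) \<le> ereal (m * (L (u \<epsilon>) / L \<epsilon>))"
      using eventually_at_right_less[of "0::real"] eventually_at_right_below[OF b(1)]
        eventually_at_right_below[OF zero_less_one]
    proof eventually_elim
      case (elim \<epsilon>)
      then have ue: "0 < u \<epsilon>" "u \<epsilon> < b" "f \<epsilon> \<le> k (u \<epsilon>)" using u[of \<epsilon>] by auto
      have Lp: "L \<epsilon> > 0" "L (u \<epsilon>) > 0" using L elim ue by auto
      have "k (u \<epsilon>) / ereal (L (u \<epsilon>)) \<le> ereal m" using b(2)[OF ue(1,2)] real by simp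
      then have "k (u \<epsilon>) \<le> ereal (m * L (u \<epsilon>))"
        using Lp by (cases "k (u \<epsilon>)") (auto simp: field_simps)
      then have "f \<epsilon> \<le> ereal (m * L (u \<epsilon>))" using ue(3) by (rule order_trans[rotated])
      then have "f \<epsilon> / ereal (L \<epsilon>) \<le> ereal (m * L (u \<epsilon>)) / ereal (L \<epsilon>)"
        using Lp by (intro ereal_divide_right_mono) auto
      then show ?case using Lp by simp
    qed
    then have le: "?l \<le> Limsup (at_right 0) (\<lambda>\<epsilon>. ereal (m * (L (u \<epsilon>) / L \<epsilon>)))" by (rule Limsup_mono)
    have "((\<lambda>\<epsilon>. ereal (m * (L (u \<epsilon>) / L \<epsilon>))) \<longlongrightarrow> ereal (m * 1)) (at_right 0)"
      by (intro tendsto_ereal tendsto_mult tendsto_const ratio)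
    from lim_imp_Limsup[OF trivial_limit_at_right_real this] show ?thesis
      using le real by simp
  qed (use z in auto)
qed

text \<open>As \<open>G\<close> generates \<open>A\<close>, both dimensions use the same sets
  \<open>F\<close> and differ only in the supremum over \<open>E\<close>, so one inequality is
  monotonicity. For the other, \<open>E\<close> is replaced by a finite list of generators at the
  scale \<open>\<omega> \<epsilon>\<close>, whose effect on the normalization is absorbed by the
  growth condition.\<close>

lemma entropy_dim_generating:
  fixes \<L> :: "('f, 'g, 'i) lang"
  assumes L: "language \<L>" and A: "struct_of \<L> A" and As: "\<And>r. r \<ge> 1 \<Longrightarrow> struct_of \<L> (As r)"
    and N: "\<And>r. r \<ge> 1 \<Longrightarrow> N r > 0" and Lp: "\<And>\<epsilon>. \<epsilon> > 0 \<Longrightarrow> L \<epsilon> > 0"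
    and G: "G \<subseteq> carr A" "generated \<L> A G = carr A"
    and lim: "\<And>\<eta> c. \<eta> \<in> continuity_symbols \<L> \<Longrightarrow> 0 < c \<Longrightarrow> c < 1 \<Longrightarrow>
      ((\<lambda>\<epsilon>. L (\<eta> (c * \<epsilon>) / 2) / L \<epsilon>) \<longlongrightarrow> 1) (at_right 0)"
  shows "entropy_dim MS \<L> A As N L (carr A) = entropy_dim MS \<L> A As N L G"
proof (rule antisym)
  let ?h = "entropy_at MS \<L> A As N"
  show "entropy_dim MS \<L> A As N L G \<le> entropy_dim MS \<L> A As N L (carr A)"
    unfolding entropy_dim_def generated_carr[OF A] G(2) using G(1) by (intro SUP_subset_mono) auto
  show "entropy_dim MS \<L> A As N L (carr A) \<le> entropy_dim MS \<L> A As N L G"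
    unfolding entropy_dim_def[of MS \<L> A As N L "carr A"] generated_carr[OF A]
  proof (intro SUP_least)
    fix E assume "E \<in> {E. finite E \<and> E \<subseteq> carr A}"
    then have E: "finite E" "E \<subseteq> carr A" by auto
    obtain xs t where xs: "set xs \<subseteq> G" "G \<noteq> {} \<Longrightarrow> xs \<noteq> []"
      and t: "\<And>e. e \<in> E \<Longrightarrow> t e \<in> terms \<L> (length xs)" "\<And>e. e \<in> E \<Longrightarrow> e = eval A xs (t e)"
      using finite_subset_generated[OF E(1)] E(2) G(2) by metis
    obtain Ds where Ds: "Ds \<in> dom_tuples \<L> (length xs)" "\<And>i. i < length xs \<Longrightarrow> xs ! i \<in> dint A (Ds ! i)"
      using obtain_domain_tuple[OF A, of xs] xs G by blast
    let ?n = "length xs"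
    obtain \<omega> where \<omega>: "\<And>\<epsilon>. 0 < \<epsilon> \<Longrightarrow> \<epsilon> \<le> 1 \<Longrightarrow> 0 < \<omega> \<epsilon>" "((\<lambda>\<epsilon>. L (\<omega> \<epsilon>) / L \<epsilon>) \<longlongrightarrow> 1) (at_right 0)"
      "\<And>\<epsilon>. 0 < \<epsilon> \<Longrightarrow> \<epsilon> \<le> 1 \<Longrightarrow> ?h E (carr A) \<epsilon> \<le> ?h (set xs) (carr A) (\<omega> \<epsilon>)"
    proof (cases "xs = []")
      case True
      \<comment> \<open>All of \<open>E\<close> consists of values of closed terms. No modulus
        enters, so the scale is kept, and \<open>\<epsilon>0 = 1\<close> serves because it is
        multiplied by length 0.\<close>
      show thesis
      proof (rule that[of "\<lambda>\<epsilon>. \<epsilon>"])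
        show "((\<lambda>\<epsilon>. L \<epsilon> / L \<epsilon>) \<longlongrightarrow> 1) (at_right 0)"
        proof (rule tendsto_eventually)
          show "\<forall>\<^sub>F \<epsilon> in at_right 0. L \<epsilon> / L \<epsilon> = 1"
            using eventually_at_right_less[of "0::real"] by eventually_elim (use Lp in force)
        qed
        fix \<epsilon> :: real assume "0 < \<epsilon>" "\<epsilon> \<le> 1"
        then show "?h E (carr A) \<epsilon> \<le> ?h (set xs) (carr A) \<epsilon>"
          using True by (intro entropy_at_terms_le[OF _ A As N E _ t Ds, where ?\<epsilon>0.0 = 1]) auto
      qed
    next
      case False
      \<comment> \<open>The variable term keeps \<open>T\<close> nonempty when \<open>E\<close> is
        empty, so that its minimum is a continuity symbol.\<close>
      define T :: "('f, 'g) symb set" where "T = insert (TermSym ?n (Var 0)) ((\<lambda>e. TermSym ?n (t e)) ` E)"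
      have T: "finite T" "T \<noteq> {}" "T \<subseteq> symbols \<L>" "\<And>s. s \<in> T \<Longrightarrow> arity \<L> s = ?n"
        using E(1) t(1) False by (auto simp: T_def symbols_def intro: terms.Var)
      define \<eta> where "\<eta> = (\<lambda>\<epsilon>. Min ((\<lambda>s. modulus \<L> s Ds \<epsilon>) ` T))"
      have \<eta>: "\<eta> \<in> continuity_symbols \<L>"
        unfolding continuity_symbols_def \<eta>_def using T Ds False
        by (intro CollectI exI[of _ T] exI[of _ Ds] exI[of _ ?n]) (auto simp: Suc_le_eq)
      \<comment> \<open>Changing all \<open>?n\<close> coordinates at accuracy
        \<open>c * \<epsilon>\<close> costs \<epsilon>/2 in total, leaving room for the microstate
        errors.\<close>
      define c where "c = 1 / (2 * real ?n)"
      have "real ?n \<ge> 1" using False by (cases xs) auto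
      then have c: "0 < c" "c < 1" "?n * c = 1 / 2" using False by (auto simp: c_def field_simps)
      have \<eta>pos: "0 < \<eta> (c * \<epsilon>)" and c\<epsilon>: "0 < c * \<epsilon>" "c * \<epsilon> \<le> 1" if "0 < \<epsilon>" "\<epsilon> \<le> 1" for \<epsilon>
      proof -
        show c\<epsilon>: "0 < c * \<epsilon>" "c * \<epsilon> \<le> 1" using c that by (auto intro: mult_le_one)
        have "0 < modulus \<L> s Ds (c * \<epsilon>)" if "s \<in> T" for s
          using T(3,4) that Ds(1) False by (intro modulus_bounds(1)[OF L _ _ _ c\<epsilon>]) auto
        then show "0 < \<eta> (c * \<epsilon>)" using T(1,2) by (simp add: \<eta>_def)
      qed
      show thesis
      proof (rule that[of "\<lambda>\<epsilon>. \<eta> (c * \<epsilon>) / 2"])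
        show "((\<lambda>\<epsilon>. L (\<eta> (c * \<epsilon>) / 2) / L \<epsilon>) \<longlongrightarrow> 1) (at_right 0)" using lim \<eta> c by blast
        fix \<epsilon> :: real assume e: "0 < \<epsilon>" "\<epsilon> \<le> 1"
        show "0 < \<eta> (c * \<epsilon>) / 2" using \<eta>pos[OF e] by simp
        show "?h E (carr A) \<epsilon> \<le> ?h (set xs) (carr A) (\<eta> (c * \<epsilon>) / 2)"
        proof (rule entropy_at_terms_le[OF _ A As N E _ t Ds, where ?\<epsilon>0.0 = "c * \<epsilon>"])
          show "real ?n * (c * \<epsilon>) < \<epsilon>" using c(3) e by (simp flip: mult.assoc)
          show "0 < \<eta> (c * \<epsilon>) / 2" using \<eta>pos[OF e] by simp
          fix e assume "e \<in> E"
          then have "\<eta> (c * \<epsilon>) \<le> modulus \<L> (TermSym ?n (t e)) Ds (c * \<epsilon>)"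
            unfolding \<eta>_def using T(1) by (intro Min_le) (auto simp: T_def)
          then show "\<eta> (c * \<epsilon>) / 2 \<le> modulus \<L> (TermSym ?n (t e)) Ds (c * \<epsilon>)"
            using \<eta>pos[OF \<open>0 < \<epsilon>\<close> \<open>\<epsilon> \<le> 1\<close>] by simp
        qed (use c\<epsilon>[OF e] e in auto)
      qed
    qed
    have "Limsup (at_right 0) (\<lambda>\<epsilon>. ?h E (carr A) \<epsilon> / ereal (L \<epsilon>))
        \<le> Limsup (at_right 0) (\<lambda>\<epsilon>. ?h (set xs) (carr A) \<epsilon> / ereal (L \<epsilon>))"
    proof (rule Limsup_comparison[where L = L and \<omega> = \<omega>])
      fix \<epsilon> \<epsilon>' :: real assume "0 < \<epsilon>'" "\<epsilon>' \<le> \<epsilon>"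
      then show "?h (set xs) (carr A) \<epsilon> \<le> ?h (set xs) (carr A) \<epsilon>'"
        using xs(1) G(1) by (intro entropy_at_antimono[OF _ A As N]) auto
    qed (use Lp \<omega> in auto)
    also have "\<dots> \<le> entropy_dim MS \<L> A As N L G"
      unfolding entropy_dim_def G(2) using xs(1) by (intro SUP_upper2[of "set xs"]) auto
    finally show "Limsup (at_right 0) (\<lambda>\<epsilon>. ?h E (carr A) \<epsilon> / ereal (L \<epsilon>)) \<le> entropy_dim MS \<L> A As N L G" .
  qed
qed

theorem theorem1:
  fixes \<L> :: "('f, 'g, 'i) lang"
    and A :: "('a, 'f, 'g, 'i) struct"
    and As :: "nat \<Rightarrow> ('b, 'f, 'g, 'i) struct"
    and N :: "nat \<Rightarrow> real"
    and L :: "real \<Rightarrow> real"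
    and G :: "'a set"
  assumes "language \<L>"
    and "struct_of \<L> A"
    and "\<And>r. r \<ge> 1 \<Longrightarrow> struct_of \<L> (As r)"
    and "\<And>r. r \<ge> 1 \<Longrightarrow> N r > 0"
    and "\<And>\<epsilon>. \<epsilon> > 0 \<Longrightarrow> L \<epsilon> > 0"
    and "G \<subseteq> carr A"
  shows
    "((\<forall>\<eta>\<in>continuity_symbols \<L>. \<forall>c. 0 < c \<and> c < 1 \<longrightarrow>
          ((\<lambda>\<epsilon>. L (\<eta> (c * \<epsilon>) / 2) / L \<epsilon>) \<longlongrightarrow> 1) (at_right 0)) \<and>
      generated \<L> A G = carr A
        \<longrightarrow> entropy_dim MS \<L> A As N L (carr A) = entropy_dim MS \<L> A As N L G) \<and>
     (top_generating \<L> A G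
        \<longrightarrow> entropy CMS \<L> A As N (carr A) = entropy CMS \<L> A As N G) \<and>
     (top_generating \<L> A G \<and>
      (\<exists>g\<in>gsyms \<L>. metric_symbol_in \<L> g A \<and> (\<forall>r\<ge>1. metric_symbol_in \<L> g (As r)))
        \<longrightarrow> entropy MS \<L> A As N (carr A) = entropy MS \<L> A As N G)"
proof (intro conjI impI)
  assume "(\<forall>\<eta>\<in>continuity_symbols \<L>. \<forall>c. 0 < c \<and> c < 1 \<longrightarrow>
          ((\<lambda>\<epsilon>. L (\<eta> (c * \<epsilon>) / 2) / L \<epsilon>) \<longlongrightarrow> 1) (at_right 0)) \<and>
      generated \<L> A G = carr A"
  then show "entropy_dim MS \<L> A As N L (carr A) = entropy_dim MS \<L> A As N L G"
    by (intro entropy_dim_generating assms) auto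
next
  assume "top_generating \<L> A G"
  then show "entropy CMS \<L> A As N (carr A) = entropy CMS \<L> A As N G"
    by (intro entropy_CMS_top_generating assms)
next
  assume *: "top_generating \<L> A G \<and>
      (\<exists>g\<in>gsyms \<L>. metric_symbol_in \<L> g A \<and> (\<forall>r\<ge>1. metric_symbol_in \<L> g (As r)))"
  then obtain g where g: "g \<in> gsyms \<L>" "metric_symbol_in \<L> g A" "\<And>r. r \<ge> 1 \<Longrightarrow> metric_symbol_in \<L> g (As r)"
    by blast
  \<comment> \<open>This is applied to both \<open>carr A\<close> and \<open>G\<close>, which
    reduces the claim to contractive microstates.\<close>
  have MS_CMS: "entropy MS \<L> A As N X = entropy CMS \<L> A As N X" if "X \<subseteq> carr A" for X
    by (intro entropy_MS_eq_CMS[of \<L> A N X g As] assms g that)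
  have "entropy CMS \<L> A As N (carr A) = entropy CMS \<L> A As N G"
    by (intro entropy_CMS_top_generating assms conjunct1[OF *])
  then show "entropy MS \<L> A As N (carr A) = entropy MS \<L> A As N G"
    by (simp add: MS_CMS assms(6))
qed

end
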